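(* Let $p$ be a prime and $r\ge 1$ an integer. A free convolutional code $\mathcal{C}$ over $\mathbb{Z}_{p^r}$ is non-catastrophic if and only if $\Delta_p(\mathcal{C})=D^s$ for some integer $s\ge 0$.
   Context: $\mathbb{Z}_{p^r}=\mathbb{Z}/p^r\mathbb{Z}$; $a\mapsto\overline{a}$ denotes reduction modulo $p$ onto $\mathbb{F}_p$, extended coefficientwise to polynomials, Laurent series and matrices. $\mathbb{Z}_{p^r}((D))$ is the ring of formal Laurent series in $D$ (finitely many negative powers of $D$). A free convolutional code $\mathcal{C}$ of length $n$ and rank $k$ over $\mathbb{Z}_{p^r}$ is a free submodule of $\mathbb{Z}_{p^r}((D))^n$ of rank $k$ generated by the rows of a $k\times n$ polynomial matrix $G(D)\in\mathbb{Z}_{p^r}[D]^{k\times n}$ of full rank (rows linearly independent over $\mathbb{Z}_{p^r}((D))$), i.e. $\mathcal{C}=\{\mathbf{u}(D)G(D) : \mathbf{u}(D)\in\mathbb{Z}_{p^r}((D))^k\}$. Such a $G(D)$ is called a generator matrix (or encoder) of $\mathcal{C}$. Two generator matrices in $\mathbb{Z}_{p^r}[D]^{k\times n}$ are equivalent if they generate the same code. The Hamming weight of $\mathbf{u}(D)=(u_1(D),\dots,u_m(D))\in\mathbb{Z}_{p^r}((D))^m$ is $\mathrm{wt}[\mathbf{u}(D)]=\sum_i \mathrm{wt}[u_i(D)]$, where $\mathrm{wt}[u_i(D)]$ is the (possibly infinite) number of nonzero coefficients of $u_i(D)$. A generator matrix $G(D)\in\mathbb{Z}_{p^r}[D]^{k\times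 n}$ is non-catastrophic if for all $\mathbf{u}(D)\in\mathbb{Z}_{p^r}((D))^k$: $\mathrm{wt}[\mathbf{u}(D)G(D)]<\infty \iff \mathrm{wt}[\mathbf{u}(D)]<\infty$; otherwise it is catastrophic. A code is catastrophic if every polynomial generator matrix of it is catastrophic, and non-catastrophic if it admits a non-catastrophic polynomial generator matrix. The internal degree of a generator matrix $G(D)$ is the maximum of the degrees of all $k\times k$ minors of $G(D)$. A generator matrix $G(D)$ is a reduced internal degree matrix (RIDM) if its internal degree is minimal among all polynomial generator matrices equivalent to $G(D)$. For a RIDM $G(D)$, $\Delta_p(G)\in\mathbb{F}_p[D]$ is the (monic) greatest common divisor in $\mathbb{F}_p[D]$ of the $k\times k$ minors of $\overline{G}(D)\in\mathbb{F}_p[D]^{k\times n}$. The residual structural polynomial of $\mathcal{C}$ is $\Delta_p(\mathcal{C})=\Delta_p(G)$, where $G(D)$ is any RIDM generator matrix of $\mathcal{C}$ (the value is independent of the choice of RIDM). *)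

theory Defs
  imports
    "HOL-Library.Extended_Nat"
    "HOL-Computational_Algebra.Computational_Algebra"
    "Jordan_Normal_Form.Determinant"
    "Jordan_Normal_Form.DL_Submatrix"
    "Berlekamp_Zassenhaus.Finite_Field"
begin

text \<open>
  The ring of integers modulo \<open>p ^ r\<close> is \<open>'q mod_ring\<close> with \<open>CARD('q) = p ^ r\<close>, and the residue
  field is \<open>'p mod_ring\<close> with \<open>CARD('p) = p\<close>. The notions that do not refer to reduction modulo
  \<open>p\<close> are defined over an arbitrary commutative ring.
\<close>

definition fls_of_poly :: "'a::comm_ring_1 poly \<Rightarrow> 'a fls" where
  "fls_of_poly f = fps_to_fls (fps_of_poly f)"

text \<open>The row vector \<open>u G\<close>; vectors of \<open>Jordan_Normal_Form\<close> are column vectors, hence the transpose.\<close>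

definition encode :: "'a::comm_ring_1 poly mat \<Rightarrow> 'a fls vec \<Rightarrow> 'a fls vec" where
  "encode G u = transpose_mat (map_mat fls_of_poly G) *\<^sub>v u"

definition full_rank :: "'a::comm_ring_1 poly mat \<Rightarrow> bool" where
  "full_rank G \<longleftrightarrow>
     (\<forall>u \<in> carrier_vec (dim_row G). encode G u = 0\<^sub>v (dim_col G) \<longrightarrow> u = 0\<^sub>v (dim_row G))"

definition code_of :: "'a::comm_ring_1 poly mat \<Rightarrow> 'a fls vec set" where
  "code_of G = {encode G u | u. u \<in> carrier_vec (dim_row G)}"

definition generator_matrix ::
    "nat \<Rightarrow> nat \<Rightarrow> 'a::comm_ring_1 fls vec set \<Rightarrow> 'a poly mat \<Rightarrow> bool" where
  "generator_matrix k n C G \<longleftrightarrow> G \<in> carrier_mat k n \<and> full_rank G \<and> code_of G = C"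

definition free_convolutional_code :: "nat \<Rightarrow> nat \<Rightarrow> 'a::comm_ring_1 fls vec set \<Rightarrow> bool" where
  "free_convolutional_code k n C \<longleftrightarrow> (\<exists>G. generator_matrix k n C G)"

definition fls_weight :: "'a::zero fls \<Rightarrow> enat" where
  "fls_weight f =
     (if finite {i. fls_nth f i \<noteq> 0} then enat (card {i. fls_nth f i \<noteq> 0}) else \<infinity>)"

definition hamming_weight :: "'a::zero fls vec \<Rightarrow> enat" where
  "hamming_weight u = (\<Sum>i<dim_vec u. fls_weight (vec_index u i))"

definition noncatastrophic_matrix :: "'a::comm_ring_1 poly mat \<Rightarrow> bool" where
  "noncatastrophic_matrix G \<longleftrightarrow>
     (\<forall>u \<in> carrier_vec (dim_row G). hamming_weight (encode G u) < \<infinity> \<longleftrightarrow> hamming_weight u < \<infinity>)"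

definition noncatastrophic_code :: "nat \<Rightarrow> nat \<Rightarrow> 'a::comm_ring_1 fls vec set \<Rightarrow> bool" where
  "noncatastrophic_code k n C \<longleftrightarrow> (\<exists>G. generator_matrix k n C G \<and> noncatastrophic_matrix G)"

text \<open>The minors of size \<open>dim_row G\<close>, one for each set \<open>J\<close> of as many columns.\<close>

definition full_minors :: "'a::comm_ring_1 poly mat \<Rightarrow> 'a poly set" where
  "full_minors G =
     {det (submatrix G UNIV J) | J. J \<subseteq> {..<dim_col G} \<and> card J = dim_row G}"

text \<open>
  A matrix of full rank over a nontrivial ring has a nonzero full-size minor, so the convention
  \<open>degree 0 = 0\<close> is harmless here.
\<close>

definition internal_degree :: "'a::comm_ring_1 poly mat \<Rightarrow> nat" where
  "internal_degree G = Max (degree ` full_minors G)"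

definition reduced_internal_degree_matrix ::
    "nat \<Rightarrow> nat \<Rightarrow> 'a::comm_ring_1 fls vec set \<Rightarrow> 'a poly mat \<Rightarrow> bool" where
  "reduced_internal_degree_matrix k n C G \<longleftrightarrow>
     generator_matrix k n C G \<and>
     (\<forall>G'. generator_matrix k n C G' \<longrightarrow> internal_degree G \<le> internal_degree G')"

text \<open>Reduction modulo \<open>CARD('p)\<close>; it is a ring homomorphism when \<open>CARD('p)\<close> divides \<open>CARD('q)\<close>.\<close>

definition reduce :: "'q::nontriv mod_ring \<Rightarrow> 'p::prime_card mod_ring" where
  "reduce a = of_int_mod_ring (to_int_mod_ring a)"

definition reduce_mat :: "'q::nontriv mod_ring poly mat \<Rightarrow> 'p::prime_card mod_ring poly mat" where
  "reduce_mat G = map_mat (map_poly reduce) G"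

text \<open>\<open>Gcd\<close> on polynomials over a field is normalized, that is, monic unless it is zero.\<close>

definition gcd_minors_mod_p :: "'q::nontriv mod_ring poly mat \<Rightarrow> 'p::prime_card mod_ring poly" where
  "gcd_minors_mod_p G = Gcd (full_minors (reduce_mat G))"

text \<open>
  The value does not depend on the choice of the reduced internal degree matrix; one exists for
  every free convolutional code, since internal degrees are natural numbers.
\<close>

definition residual_structural_polynomial ::
    "nat \<Rightarrow> nat \<Rightarrow> 'q::nontriv mod_ring fls vec set \<Rightarrow> 'p::prime_card mod_ring poly" where
  "residual_structural_polynomial k n C =
     gcd_minors_mod_p (SOME G. reduced_internal_degree_matrix k n C G)"

end

theory Submission
  imports Defs
begin

text \<open>
  An encoder \<open>G\<close> is noncatastrophic iff the full-size minors of its reduction have a power of \<open>D\<close>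
  as greatest common divisor, iff \<open>G Q = D ^ m\<close> for some polynomial matrix \<open>Q\<close>: since \<open>p\<close> is
  nilpotent, such an equation lifts from the residue field at the expense of a higher power of \<open>D\<close>.

  It remains to see that a noncatastrophic code has no catastrophic reduced internal degree matrix
  \<open>G\<close>. If \<open>G'\<close> is a noncatastrophic encoder with right factor \<open>Q\<close>, then \<open>D ^ m G = U G'\<close> with the
  polynomial matrix \<open>U = G Q\<close>. The cokernel of \<open>U\<close> over the Laurent polynomials is a finitely
  generated module over the coefficient ring; a basis of it modulo \<open>p\<close> consisting of monomials lifts
  by Nakayama's lemma, and yields \<open>U = B V\<close> with \<open>V\<close> invertible over the Laurent polynomials and \<open>B\<close>
  polynomial, where \<open>det B\<close> is monic and its constant term is a unit. Hence \<open>H = B\<^sup>-\<^sup>1 G\<close> is again a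
  polynomial encoder of the same code, and its minors are those of \<open>G\<close> divided by \<open>det B\<close>.
  Minimality forces \<open>det B\<close> to be constant, so that \<open>U\<close>, and with it \<open>G\<close>, is invertible on the right
  over the Laurent polynomials.
\<close>

hide_const (open) up_ring.coeff up_ring.monom module.smult

section \<open>Full-size minors and ideals\<close>

definition is_ideal :: "'a::comm_ring_1 set \<Rightarrow> bool" where
  "is_ideal I \<longleftrightarrow> 0 \<in> I \<and> (\<forall>a\<in>I. \<forall>b\<in>I. a + b \<in> I) \<and> (\<forall>a\<in>I. \<forall>c. c * a \<in> I)"

lemma is_idealD:
  assumes "is_ideal I"
  shows is_ideal_0: "0 \<in> I"
    and is_ideal_add: "a \<in> I \<Longrightarrow> b \<in> I \<Longrightarrow> a + b \<in> I"
    and is_ideal_mult: "a \<in> I \<Longrightarrow> c * a \<in> I"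
    and is_ideal_mult': "a \<in> I \<Longrightarrow> a * c \<in> I"
  using assms unfolding is_ideal_def by (auto simp: mult.commute)

text \<open>Columns may be repeated and come in any order, so that adjoining one is a function
  update of \<open>c\<close>.\<close>

definition choose_cols :: "'a::comm_ring_1 mat \<Rightarrow> nat \<Rightarrow> (nat \<Rightarrow> nat) \<Rightarrow> 'a mat" where
  "choose_cols G k c = mat k k (\<lambda>(i, j). G $$ (i, c j))"

text \<open>A minor of size \<open>t\<close> outside \<open>I\<close> is bordered by row
  \<open>t\<close> and a variable column \<open>x\<close>. Expansion along the new column is a
  combination of its entries whose coefficients do not depend on \<open>x\<close>. Either some
  \<open>x\<close> gives a larger minor outside \<open>I\<close>, or these coefficients form the
  relation; the last of them is the old minor.\<close>

lemma cofactor_relation_or_minor: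
  fixes G :: "'a::comm_ring_1 mat"
  assumes I: "is_ideal I" "1 \<notin> I" and t: "t \<le> k"
  shows "(\<exists>v i. i < t \<and> v i \<notin> I \<and> (\<forall>l<n. (\<Sum>i<t. v i * G $$ (i, l)) \<in> I)) \<or>
         (\<exists>c. (\<forall>j<t. c j < n) \<and> det (choose_cols G t c) \<notin> I)"
  using t
proof (induction t)
  case 0
  have "det (choose_cols G 0 (\<lambda>_. 0)) = 1"
    unfolding choose_cols_def by (rule det_dim_zero) auto
  then have "(\<forall>j<0::nat. (0::nat) < n) \<and> det (choose_cols G 0 (\<lambda>_. 0)) \<notin> I"
    using I(2) by simp
  then show ?case by (rule disjI2[OF exI[of _ "\<lambda>_. 0"]])
next
  case (Suc t)
  from Suc.IH[OF Suc_leD[OF Suc.prems]] show ?case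
  proof (elim disjE exE conjE)
    fix v i
    assume a: "i < t" "v i \<notin> I" "\<forall>l<n. (\<Sum>i<t. v i * G $$ (i, l)) \<in> I"
    define v' where "v' = v(t := 0)"
    have "(\<Sum>i<Suc t. v' i * G $$ (i, l)) = (\<Sum>i<t. v i * G $$ (i, l))" for l
      by (simp add: v'_def)
    then show ?thesis using a by (intro disjI1 exI[of _ v'] exI[of _ i]) (auto simp: v'_def)
  next
    fix c
    assume b: "\<forall>j<t. c j < n" "det (choose_cols G t c) \<notin> I"
    define c' where "c' x = c(t := x)" for x
    \<comment> \<open>Cofactors along column \<open>t\<close> ignore its entries, so the column
      index \<open>0\<close> is only a placeholder.\<close>
    define v where "v i = cofactor (choose_cols G (Suc t) (c' 0)) i t" for i
    have cof: "cofactor (choose_cols G (Suc t) (c' x)) i t = v i" if "i < Suc t" for x i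
      unfolding v_def cofactor_def
      by (rule arg_cong[of _ _ "\<lambda>z. _ * det z"], rule eq_matI)
        (use that in \<open>auto simp: mat_delete_def choose_cols_def c'_def\<close>)
    have det: "det (choose_cols G (Suc t) (c' x)) = (\<Sum>i<Suc t. v i * G $$ (i, x))" for x
    proof -
      have "det (choose_cols G (Suc t) (c' x)) =
         (\<Sum>i<Suc t. choose_cols G (Suc t) (c' x) $$ (i, t) *
                       cofactor (choose_cols G (Suc t) (c' x)) i t)"
        by (rule laplace_expansion_column) (auto simp: choose_cols_def)
      also have "\<dots> = (\<Sum>i<Suc t. v i * G $$ (i, x))"
        by (rule sum.cong) (auto simp: cof, auto simp: choose_cols_def c'_def mult.commute)
      finally show ?thesis .
    qed
    have vt: "v t = det (choose_cols G t c)"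
    proof -
      have "mat_delete (choose_cols G (Suc t) (c' 0)) t t = choose_cols G t c"
        by (rule eq_matI) (auto simp: mat_delete_def choose_cols_def c'_def)
      then show ?thesis by (simp add: v_def cofactor_def)
    qed
    show ?thesis
    proof (cases "\<forall>l<n. (\<Sum>i<Suc t. v i * G $$ (i, l)) \<in> I")
      case True
      with vt b show ?thesis by (intro disjI1 exI[of _ v] exI[of _ t]) auto
    next
      case False
      then obtain x where x: "x < n" "det (choose_cols G (Suc t) (c' x)) \<notin> I" using det by metis
      have "\<forall>j<Suc t. c' x j < n" using x(1) b(1) by (auto simp: c'_def less_Suc_eq)
      with x(2) show ?thesis by (intro disjI2 exI[of _ "c' x"] conjI)
    qed
  qed
qed

text \<open>Choosing columns becomes right multiplication by a 0/1 matrix, so that it is compatible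
  with left factors by associativity.\<close>

definition select_mat :: "nat \<Rightarrow> nat \<Rightarrow> (nat \<Rightarrow> nat) \<Rightarrow> 'a::comm_ring_1 mat" where
  "select_mat n k c = mat n k (\<lambda>(l, j). if l = c j then 1 else 0)"

lemma select_mat_carrier [simp]: "select_mat n k c \<in> carrier_mat n k"
  "dim_row (select_mat n k c) = n" "dim_col (select_mat n k c) = k"
  by (simp_all add: select_mat_def)

lemma mult_select_mat:
  assumes "G \<in> carrier_mat m n" "\<And>j. j < k \<Longrightarrow> c j < n"
  shows "G * select_mat n k c = mat m k (\<lambda>(i, j). G $$ (i, c j))"
proof (rule eq_matI)
  fix i j assume "i < dim_row (mat m k (\<lambda>(i, j). G $$ (i, c j)))"
    "j < dim_col (mat m k (\<lambda>(i, j). G $$ (i, c j)))"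
  then have ij: "i < m" "j < k" by auto
  have "(G * select_mat n k c) $$ (i, j) = (\<Sum>l<n. G $$ (i, l) * (if l = c j then 1 else 0))"
    using assms ij by (auto simp: select_mat_def scalar_prod_def atLeast0LessThan intro!: sum.cong)
  also have "\<dots> = (\<Sum>l<n. if l = c j then G $$ (i, l) else 0)"
    by (rule sum.cong) auto
  also have "\<dots> = G $$ (i, c j)" using assms(2)[of j] ij by simp
  finally show "(G * select_mat n k c) $$ (i, j) = mat m k (\<lambda>(i, j). G $$ (i, c j)) $$ (i, j)"
    using ij by simp
qed (use assms in auto)

lemma submatrix_columns:
  assumes "G \<in> carrier_mat k n" "J \<subseteq> {..<n}" "card J = k"
  shows "submatrix G UNIV J = choose_cols G k (pick J)"
    and "\<And>j. j < k \<Longrightarrow> pick J j < n"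
    and "submatrix G UNIV J = G * select_mat n k (pick J)"
    and "submatrix G UNIV J \<in> carrier_mat k k"
proof -
  have "{j. j < n \<and> j \<in> J} = J" using assms by auto
  then show *: "submatrix G UNIV J = choose_cols G k (pick J)"
    unfolding submatrix_def choose_cols_def using assms by (simp add: pick_UNIV)
  show **: "pick J j < n" if "j < k" for j
    using pick_in_set_le[of j J] that assms by auto
  show "submatrix G UNIV J = G * select_mat n k (pick J)"
    by (subst mult_select_mat[OF assms(1) **]) (simp_all add: * choose_cols_def)
  show "submatrix G UNIV J \<in> carrier_mat k k"
    by (simp add: * choose_cols_def)
qed

lemma finite_full_minors: "finite (full_minors G)"
proof -
  have "full_minors G \<subseteq> (\<lambda>J. det (submatrix G UNIV J)) ` Pow {..<dim_col G}"
    by (auto simp: full_minors_def)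
  then show ?thesis by (rule finite_subset) auto
qed

lemma full_minorsI:
  assumes "G \<in> carrier_mat k n" "J \<subseteq> {..<n}" "card J = k"
  shows "det (submatrix G UNIV J) \<in> full_minors G"
  using assms by (auto simp: full_minors_def)

lemma full_minorsE:
  assumes "x \<in> full_minors G" "G \<in> carrier_mat k n"
  obtains J where "J \<subseteq> {..<n}" "card J = k" "x = det (submatrix G UNIV J)"
  using assms by (auto simp: full_minors_def)

text \<open>A form of McCoy's theorem; the witness \<open>v\<close> consists of cofactors of a maximal minor
  outside \<open>I\<close>.\<close>

lemma full_minors_ideal:
  fixes G :: "'a::comm_ring_1 poly mat"
  assumes I: "is_ideal I" "1 \<notin> I" and G: "G \<in> carrier_mat k n" and sub: "full_minors G \<subseteq> I"
  obtains v i where "i < k" "v i \<notin> I" "\<And>l. l < n \<Longrightarrow> (\<Sum>i<k. v i * G $$ (i, l)) \<in> I"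
proof -
  \<comment> \<open>\<open>full_minors\<close> has only increasing choices of columns, whereas the
    dichotomy yields arbitrary ones. A repeated column gives determinant 0; otherwise a permutation
    matrix splits off.\<close>
  have "det (choose_cols G k c) \<in> I" if c: "\<forall>j<k. c j < n" for c
  proof (cases "inj_on c {..<k}")
    case False
    then obtain i j where ij: "i < k" "j < k" "i \<noteq> j" "c i = c j" by (auto simp: inj_on_def)
    have "det (choose_cols G k c) = 0"
      by (rule det_identical_columns[of _ k i j]) (use ij in \<open>auto simp: choose_cols_def\<close>)
    then show ?thesis using I by (simp add: is_ideal_0)
  next
    case True
    define J where "J = c ` {..<k}"
    have J: "J \<subseteq> {..<n}" "card J = k" using c True by (auto simp: J_def card_image)
    \<comment> \<open>The position of \<open>c j\<close> in the increasing enumeration of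
      \<open>J\<close> is the number of smaller elements of \<open>J\<close>.\<close>
    have surj: "\<exists>t<k. pick J t = c j" if "j < k" for j
    proof (intro exI conjI)
      have fin: "finite J" by (simp add: J_def)
      have "c j \<in> J" using that by (auto simp: J_def)
      then show "pick J (card {a \<in> J. a < c j}) = c j" by (rule pick_card_in_set)
      have "{a \<in> J. a < c j} \<subset> J" using \<open>c j \<in> J\<close> by auto
      then show "card {a \<in> J. a < c j} < k" using psubset_card_mono[OF fin] J by metis
    qed
    define q where "q j = (SOME t. t < k \<and> pick J t = c j)" for j
    have q: "q j < k" "pick J (q j) = c j" if "j < k" for j
      using someI_ex[OF surj[OF that]] by (auto simp: q_def)
    have "choose_cols G k c = submatrix G UNIV J * select_mat k k q"
      by (subst mult_select_mat[OF submatrix_columns(4)[OF G J] q(1)], assumption)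
        (auto simp: submatrix_columns(1)[OF G J] choose_cols_def q)
    then have "det (choose_cols G k c) = det (submatrix G UNIV J) * det (select_mat k k q :: 'a poly mat)"
      using det_mult[OF submatrix_columns(4)[OF G J], of "select_mat k k q"] by simp
    then show ?thesis using full_minorsI[OF G J] sub I by (auto intro: is_ideal_mult')
  qed
  with cofactor_relation_or_minor[OF I order.refl, of k n G] that show thesis by blast
qed

lemma submatrix_mult_left:
  fixes B :: "'a::comm_ring_1 mat"
  assumes "B \<in> carrier_mat k k" "G \<in> carrier_mat k n" "J \<subseteq> {..<n}" "card J = k"
  shows "submatrix (B * G) UNIV J = B * submatrix G UNIV J"
  unfolding submatrix_columns(3)[OF mult_carrier_mat[OF assms(1,2)] assms(3,4)]
    submatrix_columns(3)[OF assms(2-4)]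
  by (rule assoc_mult_mat[OF assms(1,2) select_mat_carrier(1)])

lemma full_minors_mult_left:
  fixes B :: "'a::comm_ring_1 poly mat"
  assumes B: "B \<in> carrier_mat k k" and G: "G \<in> carrier_mat k n"
  shows "full_minors (B * G) = (*) (det B) ` full_minors G"
proof -
  have *: "det (submatrix (B * G) UNIV J) = det B * det (submatrix G UNIV J)"
    if "J \<subseteq> {..<n}" "card J = k" for J
    unfolding submatrix_mult_left[OF B G that] by (rule det_mult[OF B submatrix_columns(4)[OF G that]])
  have dims: "dim_row (B * G) = k" "dim_col (B * G) = n" "dim_row G = k" "dim_col G = n"
    using B G by auto
  show ?thesis
    unfolding full_minors_def dims setcompr_eq_image image_image
    by (rule image_cong) (use * in auto)
qed

lemma (in comm_ring_hom) full_minors_hom: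
  fixes G :: "'a poly mat"
  assumes "G \<in> carrier_mat k n"
  shows "full_minors (map_mat (map_poly hom) G) = map_poly hom ` full_minors G"
proof -
  interpret p: map_poly_comm_ring_hom hom ..
  have "det (submatrix (map_mat (map_poly hom) G) UNIV J) = map_poly hom (det (submatrix G UNIV J))"
    if "J \<subseteq> {..<n}" "card J = k" for J
  proof -
    have "submatrix (map_mat (map_poly hom) G) UNIV J = map_mat (map_poly hom) (submatrix G UNIV J)"
    proof -
      have "map_mat (map_poly hom) G \<in> carrier_mat k n" using assms by simp
      note 1 = submatrix_columns(1)[OF this that]
      show ?thesis
        unfolding 1 submatrix_columns(1)[OF assms that] choose_cols_def
        by (rule eq_matI) (use submatrix_columns(2)[OF assms that] assms in auto)
    qed
    then show ?thesis by simp
  qed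
  then show ?thesis using assms unfolding full_minors_def setcompr_eq_image image_image
    by (intro image_cong) auto
qed

text \<open>This is the annihilator of the cokernel of \<open>G\<close> acting on columns. A power
  of \<open>D\<close> in it amounts to a right inverse of \<open>G\<close> over the Laurent
  polynomials.\<close>

definition right_factor_ideal :: "nat \<Rightarrow> nat \<Rightarrow> 'a::comm_ring_1 mat \<Rightarrow> 'a set" where
  "right_factor_ideal k n G = {x. \<exists>Q\<in>carrier_mat n k. G * Q = x \<cdot>\<^sub>m 1\<^sub>m k}"

lemma is_ideal_right_factor_ideal:
  assumes G: "G \<in> carrier_mat k n"
  shows "is_ideal (right_factor_ideal k n G)"
  unfolding is_ideal_def
proof (intro conjI ballI allI)
  show "0 \<in> right_factor_ideal k n G"
    unfolding right_factor_ideal_def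
    by (intro CollectI bexI[of _ "0\<^sub>m n k"]) (use G in auto)
next
  fix a b assume "a \<in> right_factor_ideal k n G" "b \<in> right_factor_ideal k n G"
  then obtain P Q where "P \<in> carrier_mat n k" "G * P = a \<cdot>\<^sub>m 1\<^sub>m k"
    "Q \<in> carrier_mat n k" "G * Q = b \<cdot>\<^sub>m 1\<^sub>m k" by (auto simp: right_factor_ideal_def)
  then show "a + b \<in> right_factor_ideal k n G"
    unfolding right_factor_ideal_def
    by (intro CollectI bexI[of _ "P + Q"])
      (use G in \<open>auto simp: mult_add_distrib_mat[of _ k n _ k] add_smult_distrib_right_mat\<close>)
next
  fix a c assume "a \<in> right_factor_ideal k n G"
  then obtain P where "P \<in> carrier_mat n k" "G * P = a \<cdot>\<^sub>m 1\<^sub>m k"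
    by (auto simp: right_factor_ideal_def)
  then show "c * a \<in> right_factor_ideal k n G"
    unfolding right_factor_ideal_def
    by (intro CollectI bexI[of _ "c \<cdot>\<^sub>m P"])
      (use G in \<open>auto simp: mult_smult_distrib[of _ k n _ k] mult.assoc\<close>)
qed

text \<open>Selecting the columns \<open>J\<close> and multiplying by the adjugate of the resulting
  square matrix puts its determinant on the diagonal.\<close>

lemma full_minors_right_factor_ideal:
  assumes G: "G \<in> carrier_mat k n"
  shows "full_minors G \<subseteq> right_factor_ideal k n G"
proof
  fix x assume "x \<in> full_minors G"
  then obtain J where J: "J \<subseteq> {..<n}" "card J = k" and x: "x = det (submatrix G UNIV J)"
    using G by (rule full_minorsE)
  let ?S = "submatrix G UNIV J" and ?E = "select_mat n k (pick J)"
  note adj = adj_mat[OF submatrix_columns(4)[OF G J]]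
  have "G * (?E * adj_mat ?S) = (G * ?E) * adj_mat ?S"
    using G adj by (simp add: assoc_mult_mat[of _ k n _ k _ k])
  also have "\<dots> = x \<cdot>\<^sub>m 1\<^sub>m k"
    using adj(2) submatrix_columns(3)[OF G J] by (simp add: x)
  finally show "x \<in> right_factor_ideal k n G"
    unfolding right_factor_ideal_def
    by (intro CollectI bexI[of _ "?E * adj_mat ?S"] mult_carrier_mat[of _ n k]) (use adj in auto)
qed

lemma is_ideal_Gcd:
  fixes I :: "'a::euclidean_ring_gcd set"
  assumes I: "is_ideal I" and "finite A" "A \<subseteq> I"
  shows "Gcd A \<in> I"
  using assms(2,3)
proof (induction A rule: finite_induct)
  case empty
  then show ?case using I by (simp add: is_ideal_0)
next
  case (insert x A)
  obtain a b where "bezout_coefficients x (Gcd A) = (a, b)" by force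
  from bezout_coefficients[OF this] have "Gcd (insert x A) = a * x + b * Gcd A"
    by (simp add: bezout_coefficients_fst_snd)
  then show ?case using insert I by (auto intro!: is_ideal_add is_ideal_mult)
qed

section \<open>Matrices with bounded row degrees\<close>

lemma mult_mat_index:
  assumes "A \<in> carrier_mat m n" "B \<in> carrier_mat n l" "i < m" "j < l"
  shows "(A * B) $$ (i, j) = (\<Sum>t<n. A $$ (i, t) * B $$ (t, j))"
  using assms by (auto simp: scalar_prod_def atLeast0LessThan intro!: sum.cong)

text \<open>The bounds are strict and refer to coefficients, so that \<open>d i = 0\<close> makes
  row \<open>i\<close> vanish; with \<open>degree 0 = 0\<close> a strict bound on
  \<open>degree\<close> could not express this.\<close>

definition row_degrees_below :: "(nat \<Rightarrow> nat) \<Rightarrow> 'a::comm_ring_1 poly mat \<Rightarrow> bool" where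
  "row_degrees_below d S \<longleftrightarrow>
     (\<forall>i<dim_row S. \<forall>j<dim_col S. \<forall>t\<ge>d i. coeff (S $$ (i, j)) t = 0)"

definition monom_diag :: "nat \<Rightarrow> (nat \<Rightarrow> nat) \<Rightarrow> 'a::comm_ring_1 poly mat" where
  "monom_diag k d = mat k k (\<lambda>(i, j). if i = j then monom 1 (d i) else 0)"

lemma monom_diag_carrier [simp]: "monom_diag k d \<in> carrier_mat k k"
  and monom_diag_dim [simp]: "dim_row (monom_diag k d) = k" "dim_col (monom_diag k d) = k"
  by (simp_all add: monom_diag_def)

section \<open>Determinants and division with bounded row degrees\<close>

lemma prod_degree_le_coeff:
  fixes f :: "'b \<Rightarrow> 'a::comm_ring_1 poly"
  assumes "finite A" "\<And>i. i \<in> A \<Longrightarrow> degree (f i) \<le> d i"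
  shows "degree (prod f A) \<le> sum d A \<and> coeff (prod f A) (sum d A) = (\<Prod>i\<in>A. coeff (f i) (d i))"
  using assms
proof (induction A rule: finite_induct)
  case (insert x A)
  then have IH: "degree (prod f A) \<le> sum d A" "coeff (prod f A) (sum d A) = (\<Prod>i\<in>A. coeff (f i) (d i))"
    and x: "degree (f x) \<le> d x" by auto
  have "degree (f x * prod f A) \<le> d x + sum d A"
    using degree_mult_le[of "f x" "prod f A"] IH x by linarith
  moreover have "coeff (f x * prod f A) (d x + sum d A) = coeff (f x) (d x) * coeff (prod f A) (sum d A)"
  proof -
    have "coeff (f x) i * coeff (prod f A) (d x + sum d A - i) = 0"
      if "i \<le> d x + sum d A" "i \<noteq> d x" for i
    proof (cases "i < d x")
      case True
      then have "coeff (prod f A) (d x + sum d A - i) = 0" by (intro coeff_eq_0) (use IH in linarith)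
      then show ?thesis by simp
    next
      case False
      then have "coeff (f x) i = 0" by (intro coeff_eq_0) (use x that in linarith)
      then show ?thesis by simp
    qed
    then have "(\<Sum>i\<le>d x + sum d A. coeff (f x) i * coeff (prod f A) (d x + sum d A - i)) =
       (\<Sum>i\<in>{d x}. coeff (f x) i * coeff (prod f A) (d x + sum d A - i))"
      by (intro sum.mono_neutral_right) auto
    then show ?thesis by (simp add: coeff_mult)
  qed
  ultimately show ?case using insert IH by simp
qed simp

text \<open>Each product in the Leibniz expansion takes one entry per row, so the coefficient at the
  sum of the row bounds only sees the leading row coefficient matrix.\<close>

lemma det_row_degrees:
  fixes A :: "'a::comm_ring_1 poly mat"
  assumes A: "A \<in> carrier_mat k k" and deg: "\<And>i j. i < k \<Longrightarrow> j < k \<Longrightarrow> degree (A $$ (i, j)) \<le> d i"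
  shows "degree (det A) \<le> (\<Sum>i<k. d i)"
    and "coeff (det A) (\<Sum>i<k. d i) = det (mat k k (\<lambda>(i, j). coeff (A $$ (i, j)) (d i)))"
proof -
  have p: "degree (\<Prod>i<k. A $$ (i, p i)) \<le> (\<Sum>i<k. d i) \<and>
      coeff (\<Prod>i<k. A $$ (i, p i)) (\<Sum>i<k. d i) = (\<Prod>i<k. coeff (A $$ (i, p i)) (d i))"
    if "p permutes {0..<k}" for p
    by (rule prod_degree_le_coeff) (use that deg permutes_in_image[OF that] in auto)
  have sg: "(signof p :: 'a poly) = [:signof p:]" for p :: "nat \<Rightarrow> nat"
    by (auto simp: sign_def one_pCons)
  have det: "det A = (\<Sum>p\<in>{p. p permutes {0..<k}}. smult (signof p) (\<Prod>i<k. A $$ (i, p i)))"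
    unfolding det_def'[OF A] by (simp add: sg atLeast0LessThan)
  show "degree (det A) \<le> (\<Sum>i<k. d i)"
    unfolding det by (rule degree_sum_le)
      (use p order.trans[OF degree_smult_le] in \<open>auto simp: finite_permutations\<close>)
  show "coeff (det A) (\<Sum>i<k. d i) = det (mat k k (\<lambda>(i, j). coeff (A $$ (i, j)) (d i)))"
    unfolding det coeff_sum
    by (subst det_def'[of _ k], simp, rule sum.cong)
      (use p in \<open>auto simp: atLeast0LessThan intro!: prod.cong arg_cong2[of _ _ _ _ "(*)"]\<close>)
qed

text \<open>\<open>S\<close> stays strictly below the diagonal monomials, so the leading row
  coefficient matrix is the identity.\<close>

lemma det_monic:
  fixes S :: "'a::comm_ring_1 poly mat"
  assumes S: "S \<in> carrier_mat k k" "row_degrees_below d S"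
  shows "degree (det (monom_diag k d - S)) \<le> (\<Sum>i<k. d i)"
    and "coeff (det (monom_diag k d - S)) (\<Sum>i<k. d i) = 1"
proof -
  have ent: "(monom_diag k d - S) $$ (i, j) = (if i = j then monom 1 (d i) else 0) - S $$ (i, j)"
    if "i < k" "j < k" for i j
    using that S by (auto simp: monom_diag_def)
  have co: "coeff (S $$ (i, j)) t = 0" if "i < k" "j < k" "t \<ge> d i" for i j t
    using that S by (auto simp: row_degrees_below_def)
  have B: "monom_diag k d - S \<in> carrier_mat k k" using S by auto
  have deg: "degree ((monom_diag k d - S) $$ (i, j)) \<le> d i" if "i < k" "j < k" for i j
    unfolding ent[OF that] by (rule degree_le) (use co[OF that] in auto)
  show "degree (det (monom_diag k d - S)) \<le> (\<Sum>i<k. d i)"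
    by (rule det_row_degrees(1)[OF B deg])
  have "mat k k (\<lambda>(i, j). coeff ((monom_diag k d - S) $$ (i, j)) (d i)) = 1\<^sub>m k"
    by (rule eq_matI) (auto simp: ent co)
  then show "coeff (det (monom_diag k d - S)) (\<Sum>i<k. d i) = 1"
    by (subst det_row_degrees(2)[OF B deg]) auto
qed

lemma degree_mult_monic:
  fixes f g :: "'a::comm_ring_1 poly"
  assumes "degree f \<le> n" "coeff f n = 1" "g \<noteq> 0"
  shows "degree (f * g) = n + degree g" 
proof (rule antisym)
  show "degree (f * g) \<le> n + degree g" using degree_mult_le[of f g] assms by linarith
  have "degree f = n" using assms by (metis le_antisym le_degree zero_neq_one)
  then have "coeff (f * g) (n + degree g) = coeff g (degree g)"
    using coeff_mult_degree_sum[of f g] assms by simp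
  then show "n + degree g \<le> degree (f * g)" using assms by (intro le_degree) auto
qed

text \<open>Horner-like recursion on the degree of \<open>X\<close>: the constant coefficients are
  split off, and the rest, divided by \<open>D\<close>, is treated inductively. Multiplying back by
  \<open>D\<close> raises the row degrees of the remainder by at most one, which a constant matrix
  corrects.\<close>

lemma mat_division:
  fixes X S0 :: "'a::comm_ring_1 poly mat"
  assumes S0: "S0 \<in> carrier_mat k k" "row_degrees_below d S0" and X: "X \<in> carrier_mat k m"
  shows "\<exists>Q\<in>carrier_mat k m. \<exists>S\<in>carrier_mat k m.
           row_degrees_below d S \<and> X = (monom_diag k d - S0) * Q + S"
proof -
  let ?B = "monom_diag k d - S0"
  have B: "?B \<in> carrier_mat k k" using S0 by auto
  have co: "coeff (S0 $$ (i, j)) t = 0" if "i < k" "j < k" "t \<ge> d i" for i j t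
    using that S0 by (auto simp: row_degrees_below_def)
  have "\<exists>Q\<in>carrier_mat k m. \<exists>S\<in>carrier_mat k m. row_degrees_below d S \<and> X = ?B * Q + S"
    if "X \<in> carrier_mat k m" "\<forall>i<k. \<forall>j<m. \<forall>t\<ge>N. coeff (X $$ (i, j)) t = 0" for N X
    using that
  proof (induction N arbitrary: X)
    case 0
    then have "X = 0\<^sub>m k m" by (intro eq_matI) (auto intro: poly_eqI)
    then have "X = ?B * 0\<^sub>m k m + 0\<^sub>m k m" by (simp add: right_mult_zero_mat[OF B])
    moreover have "row_degrees_below d (0\<^sub>m k m :: 'a poly mat)" by (simp add: row_degrees_below_def)
    ultimately show ?case by (metis zero_carrier_mat)
  next
    case (Suc N)
    define X' where "X' = map_mat (poly_shift 1) X"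
    have X': "X' \<in> carrier_mat k m" using Suc.prems by (simp add: X'_def)
    have "\<forall>i<k. \<forall>j<m. \<forall>t\<ge>N. coeff (X' $$ (i, j)) t = 0"
      using Suc.prems by (auto simp: X'_def coeff_poly_shift)
    from Suc.IH[OF X' this] obtain Q' S' where Q': "Q' \<in> carrier_mat k m"
      and S': "S' \<in> carrier_mat k m" "row_degrees_below d S'" and eq: "X' = ?B * Q' + S'" by blast
    have split: "X $$ (i, j) = pCons (coeff (X $$ (i, j)) 0) (X' $$ (i, j))" if "i < k" "j < m" for i j
      using that Suc.prems by (intro poly_eqI) (auto simp: X'_def coeff_poly_shift coeff_pCons split: nat.split)
    \<comment> \<open>Row \<open>i\<close> of \<open>Y\<close> may reach degree \<open>d i\<close>,
      and \<open>E\<close> collects the coefficients there. The leading row coefficient matrix of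
      \<open>?B\<close> is the identity, so subtracting \<open>?B * E\<close> removes exactly
      these.\<close>
    define Y where "Y = mat k m (\<lambda>(i, j). pCons (coeff (X $$ (i, j)) 0) (S' $$ (i, j)))"
    define E where "E = mat k m (\<lambda>(i, j). [:coeff (Y $$ (i, j)) (d i):])"
    have Y: "Y \<in> carrier_mat k m" and E: "E \<in> carrier_mat k m" by (auto simp: Y_def E_def)
    define S where "S = Y - ?B * E"
    have S: "S \<in> carrier_mat k m"
      unfolding S_def by (rule minus_carrier_mat, rule mult_carrier_mat[OF B E])
    have "row_degrees_below d S"
      unfolding row_degrees_below_def
    proof (intro allI impI)
      fix i j t assume "i < dim_row S" "j < dim_col S" and t: "d i \<le> t"
      then have ij: "i < k" "j < m" using S by auto
      have "(?B * E) $$ (i, j) = (\<Sum>l<k. ?B $$ (i, l) * E $$ (l, j))"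
        by (rule mult_mat_index[OF B E ij])
      also have "\<dots> = (\<Sum>l<k. (if l = i then monom 1 (d i) * E $$ (i, j) else 0) - S0 $$ (i, l) * E $$ (l, j))"
        by (rule sum.cong) (use ij S0 in \<open>auto simp: monom_diag_def algebra_simps\<close>)
      also have "\<dots> = monom 1 (d i) * E $$ (i, j) - (\<Sum>l<k. S0 $$ (i, l) * E $$ (l, j))"
        using ij by (simp add: sum_subtractf)
      finally have "coeff ((?B * E) $$ (i, j)) t = coeff (monom 1 (d i) * E $$ (i, j)) t"
        using ij t co by (simp add: coeff_sum E_def mult.commute[of _ "[:_:]"])
      also have "\<dots> = coeff (Y $$ (i, j)) t"
      proof (cases "t = d i")
        case True
        then show ?thesis using ij by (simp add: E_def coeff_monom_mult)
      next
        case False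
        then have "t > d i" using t by simp
        then have "coeff (S' $$ (i, j)) (t - 1) = 0"
          using S' ij by (auto simp: row_degrees_below_def)
        then show ?thesis using ij \<open>t > d i\<close>
          by (cases t) (simp_all add: E_def Y_def coeff_monom_mult)
      qed
      finally show "coeff (S $$ (i, j)) t = 0" using ij Y S0 E by (simp add: S_def del: index_mult_mat(1))
    qed
    moreover have "X = ?B * ([:0, 1:] \<cdot>\<^sub>m Q' + E) + S"
    proof -
      have "?B * ([:0, 1:] \<cdot>\<^sub>m Q' + E) = [:0, 1:] \<cdot>\<^sub>m (?B * Q') + ?B * E"
        using mult_add_distrib_mat[OF B, of "[:0, 1:] \<cdot>\<^sub>m Q'" m E] mult_smult_distrib[OF B Q'] Q' E by simp
      moreover have "X = [:0, 1:] \<cdot>\<^sub>m (?B * Q') + ?B * E + S"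
      proof (rule eq_matI)
        fix i j
        assume "i < dim_row ([:0, 1:] \<cdot>\<^sub>m (?B * Q') + ?B * E + S)"
          "j < dim_col ([:0, 1:] \<cdot>\<^sub>m (?B * Q') + ?B * E + S)"
        then have ij: "i < k" "j < m" using S by auto
        have 1: "dim_row (?B * Q') = k" "dim_col (?B * Q') = m" "dim_row (?B * E) = k" "dim_col (?B * E) = m"
          using B Q' E by auto
        have "X' $$ (i, j) = (?B * Q') $$ (i, j) + S' $$ (i, j)"
          unfolding eq using ij S' 1 by simp
        then show "X $$ (i, j) = ([:0, 1:] \<cdot>\<^sub>m (?B * Q') + ?B * E + S) $$ (i, j)"
          by (subst split[OF ij]) (use ij S' Y 1 in \<open>simp add: S_def Y_def del: index_mult_mat(1)\<close>)
      qed (use Suc.prems S in auto)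
      ultimately show ?thesis by simp
    qed
    ultimately show ?case using S Q' E
      by (intro bexI[of _ "[:0, 1:] \<cdot>\<^sub>m Q' + E"] bexI[of _ S]) auto
  qed
  moreover have "\<exists>N. \<forall>i<k. \<forall>j<m. \<forall>t\<ge>N. coeff (X $$ (i, j)) t = 0"
  proof -
    define N where "N = (\<Sum>i<k. \<Sum>j<m. Suc (degree (X $$ (i, j))))"
    have "coeff (X $$ (i, j)) t = 0" if "i < k" "j < m" "t \<ge> N" for i j t
    proof -
      have "Suc (degree (X $$ (i, j))) \<le> (\<Sum>j<m. Suc (degree (X $$ (i, j))))"
        using that by (intro member_le_sum) auto
      also have "\<dots> \<le> N" unfolding N_def using that
        by (intro member_le_sum[of i "{..<k}" "\<lambda>i. \<Sum>j<m. Suc (degree (X $$ (i, j)))"]) auto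
      finally show ?thesis using that by (intro coeff_eq_0) auto
    qed
    then show ?thesis by blast
  qed
  ultimately show ?thesis using X by blast
qed

lemma poly_split_monom:
  fixes p :: "'a::comm_ring_1 poly"
  assumes "p \<noteq> 0"
  obtains a g where "p = monom 1 a * g" "coeff g 0 \<noteq> 0"
proof -
  have "\<exists>a g. p = monom 1 a * g \<and> coeff g 0 \<noteq> 0"
    using assms
  proof (induction p)
    case (pCons c p)
    show ?case
    proof (cases "c = 0")
      case True
      with pCons obtain a g where "p = monom 1 a * g" "coeff g 0 \<noteq> 0" by auto
      then have "pCons c p = monom 1 (Suc a) * g \<and> coeff g 0 \<noteq> 0"
        using True by (simp add: monom_Suc)
      then show ?thesis by blast
    next
      case False
      then have "pCons c p = monom 1 0 * pCons c p \<and> coeff (pCons c p) 0 \<noteq> 0" by simp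
      then show ?thesis by blast
    qed
  qed simp
  then show thesis using that by blast
qed

text \<open>After scaling, \<open>g = 1 - D e\<close>, which divides \<open>1 - (D e) ^ m\<close>;
  so \<open>D ^ m\<close> and \<open>g\<close> are coprime.\<close>

lemma monom_unit_mod:
  fixes g :: "'a::field poly"
  assumes "coeff g 0 \<noteq> 0"
  obtains \<alpha> \<beta> where "monom 1 m * \<alpha> + g * \<beta> = 1"
proof -
  obtain c h where g: "g = pCons c h" by (cases g)
  with assms have c: "c \<noteq> 0" by simp
  define e where "e = smult (- inverse c) h"
  have "g * [:inverse c:] = 1 - [:0, 1:] * e"
    using c by (simp add: g e_def one_pCons)
  then have "g dvd 1 - [:0, 1:] * e" by (metis dvd_triv_left)
  also have "1 - [:0, 1:] * e dvd 1 - ([:0, 1:] * e) ^ m"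
    using power_diff_sumr2[of 1 m "[:0, 1:] * e"] by simp
  finally obtain \<beta> where "1 - ([:0, 1:] * e) ^ m = g * \<beta>" by (elim dvdE)
  moreover have "([:0, 1:] * e) ^ m = monom 1 m * e ^ m"
    unfolding power_mult_distrib by (simp add: monom_altdef)
  ultimately show thesis by (intro that[of "e ^ m" \<beta>]) (simp add: algebra_simps)
qed

section \<open>Monomial bases modulo the columns of a matrix\<close>

text \<open>Modulo the columns of \<open>U\<close>, and after inverting \<open>D\<close>, every matrix over the Laurent
  polynomials is represented by a polynomial one with small row degrees. Denominators are cleared
  so that only polynomial matrices occur.\<close>

definition spanning_degrees :: "nat \<Rightarrow> 'a::comm_ring_1 poly mat \<Rightarrow> (nat \<Rightarrow> nat) \<Rightarrow> bool" where
  "spanning_degrees k U d \<longleftrightarrow>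
     (\<forall>X\<in>carrier_mat k k. \<forall>m. \<exists>e. \<exists>S\<in>carrier_mat k k. \<exists>Y\<in>carrier_mat k k.
        row_degrees_below d S \<and> monom 1 e \<cdot>\<^sub>m X = monom 1 (e + m) \<cdot>\<^sub>m S + U * Y)"

lemma monom_1_add: "monom 1 (a + b) = (monom 1 a * monom 1 b :: 'a::comm_semiring_1 poly)"
  by (simp add: mult_monom)

text \<open>With \<open>det U = D ^ a g\<close>, the adjugate shows that \<open>D ^ a g\<close>
  annihilates the cokernel of \<open>U\<close>. Since \<open>D ^ m \<alpha>\<close> is 1 modulo
  \<open>g\<close>, the matrix \<open>D ^ a X\<close> is represented by \<open>D ^ (a + m)\<close>
  times \<open>\<alpha> X mod g\<close>.\<close>

lemma spanning_degrees_exist: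
  fixes U :: "'a::field_gcd poly mat"
  assumes U: "U \<in> carrier_mat k k" and det: "det U \<noteq> 0"
  shows "\<exists>d. spanning_degrees k U d"
proof -
  obtain a g where g: "det U = monom 1 a * g" "coeff g 0 \<noteq> 0"
    using poly_split_monom[OF det] by blast
  have "g \<noteq> 0" using g by auto
  have "spanning_degrees k U (\<lambda>_. degree g)"
    unfolding spanning_degrees_def
  proof (intro ballI allI)
    fix X :: "'a poly mat" and m assume X: "X \<in> carrier_mat k k"
    obtain \<alpha> \<beta> where ab: "monom 1 m * \<alpha> + g * \<beta> = 1"
      using monom_unit_mod[OF g(2)] by blast
    define S where "S = map_mat (\<lambda>x. (\<alpha> * x) mod g) X"
    \<comment> \<open>The entries of \<open>W\<close> are the quotients in
      \<open>x = D ^ m (\<alpha> x mod g) + g w\<close>, which comes from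
      \<open>x = D ^ m \<alpha> x + g \<beta> x\<close>.\<close>
    define W where "W = map_mat (\<lambda>x. monom 1 m * ((\<alpha> * x) div g) + \<beta> * x) X"
    have S: "S \<in> carrier_mat k k" and W: "W \<in> carrier_mat k k" using X by (auto simp: S_def W_def)
    have "coeff ((\<alpha> * x) mod g) t = 0" if "t \<ge> degree g" for x t
      using degree_mod_less[OF \<open>g \<noteq> 0\<close>, of "\<alpha> * x"] that by (auto intro: coeff_eq_0)
    then have "row_degrees_below (\<lambda>_. degree g) S"
      using X by (auto simp: row_degrees_below_def S_def)
    moreover have "monom 1 a \<cdot>\<^sub>m X = monom 1 (a + m) \<cdot>\<^sub>m S + U * (adj_mat U * W)"
    proof -
      note adj = adj_mat[OF U]
      have "U * (adj_mat U * W) = (U * adj_mat U) * W"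
        by (rule assoc_mult_mat[symmetric, OF U adj(1) W])
      also have "\<dots> = det U \<cdot>\<^sub>m W" using adj(2) mult_smult_assoc_mat[OF one_carrier_mat W, of "det U"] W by simp
      finally have 1: "U * (adj_mat U * W) = (monom 1 a * g) \<cdot>\<^sub>m W" by (simp add: g)
      have entry: "monom 1 a * x = monom 1 (a + m) * ((\<alpha> * x) mod g) +
               monom 1 a * g * (monom 1 m * ((\<alpha> * x) div g) + \<beta> * x)" for x
      proof -
        have "monom 1 (a + m) * r + monom 1 a * g * (monom 1 m * q + \<beta> * x) =
          monom 1 a * (monom 1 m * (g * q + r) + g * \<beta> * x)" for q r
          unfolding monom_1_add by (simp add: algebra_simps)
        from this[of "(\<alpha> * x) mod g" "(\<alpha> * x) div g"]
        have "monom 1 (a + m) * ((\<alpha> * x) mod g) +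
            monom 1 a * g * (monom 1 m * ((\<alpha> * x) div g) + \<beta> * x) =
          monom 1 a * ((monom 1 m * \<alpha> + g * \<beta>) * x)"
          by (simp only: mult_div_mod_eq distrib_right mult.assoc)
        then show ?thesis using ab by simp
      qed
      show ?thesis unfolding 1
      proof (rule eq_matI)
        fix i j assume "i < dim_row (monom 1 (a + m) \<cdot>\<^sub>m S + (monom 1 a * g) \<cdot>\<^sub>m W)"
          "j < dim_col (monom 1 (a + m) \<cdot>\<^sub>m S + (monom 1 a * g) \<cdot>\<^sub>m W)"
        then have "i < k" "j < k" using W by auto
        then show "(monom 1 a \<cdot>\<^sub>m X) $$ (i, j) =
            (monom 1 (a + m) \<cdot>\<^sub>m S + (monom 1 a * g) \<cdot>\<^sub>m W) $$ (i, j)"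
          using entry[of "X $$ (i, j)"] X by (simp add: S_def W_def)
      qed (use X W in auto)
    qed
    ultimately show "\<exists>e. \<exists>S\<in>carrier_mat k k. \<exists>Y\<in>carrier_mat k k.
        row_degrees_below (\<lambda>_. degree g) S \<and> monom 1 e \<cdot>\<^sub>m X = monom 1 (e + m) \<cdot>\<^sub>m S + U * Y"
      using S W adj_mat(1)[OF U] by (metis mult_carrier_mat)
  qed
  then show ?thesis by blast
qed

lemma smult_smult_mat:
  fixes A :: "'a::comm_ring_1 mat"
  shows "a \<cdot>\<^sub>m (b \<cdot>\<^sub>m A) = (a * b) \<cdot>\<^sub>m A"
  by (intro eq_matI) (auto simp: mult.assoc)

lemma smult_mult_mat:
  fixes A :: "'a::comm_ring_1 mat"
  assumes "A \<in> carrier_mat m n" "B \<in> carrier_mat n l"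
  shows "c \<cdot>\<^sub>m (A * B) = A * (c \<cdot>\<^sub>m B)" "c \<cdot>\<^sub>m (A * B) = (c \<cdot>\<^sub>m A) * B"
  using assms by (simp_all add: mult_smult_distrib mult_smult_assoc_mat)

text \<open>If the representatives for a degree vector \<open>d\<close> are not unique, a suitable multiple of a
  nonzero representative of zero reaches the top degree in some row, and that degree can be
  decreased.\<close>

lemma spanning_degrees_decrease:
  fixes U :: "'a::field poly mat"
  assumes U: "U \<in> carrier_mat k k" and d: "spanning_degrees k U d"
    and S: "S \<in> carrier_mat k k" "row_degrees_below d S" "S \<noteq> 0\<^sub>m k k"
    and Y: "Y \<in> carrier_mat k k" and eq: "monom 1 m \<cdot>\<^sub>m S = U * Y"
  obtains i where "i < k" "d i > 0" "spanning_degrees k U (d(i := d i - 1))"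
proof -
  have S0: "coeff (S $$ (i, j)) t = 0" if "i < k" "j < k" "t \<ge> d i" for i j t
    using that S by (auto simp: row_degrees_below_def)
  \<comment> \<open>\<open>P t\<close> says that multiplication by \<open>D ^ t\<close> brings a
    nonzero coefficient of \<open>S\<close> to the top degree \<open>d i - 1\<close> of some row.
    The least such shift keeps all rows within their bounds.\<close>
  define P where "P t \<longleftrightarrow> (\<exists>i<k. \<exists>j<k. t < d i \<and> coeff (S $$ (i, j)) (d i - 1 - t) \<noteq> 0)" for t
  have "\<exists>i<k. \<exists>j<k. S $$ (i, j) \<noteq> 0"
  proof (rule ccontr)
    assume "\<not> (\<exists>i<k. \<exists>j<k. S $$ (i, j) \<noteq> 0)"
    then have "S = 0\<^sub>m k k" using S(1) by (intro eq_matI) auto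
    then show False using S by simp
  qed
  then obtain i j where ij: "i < k" "j < k" "S $$ (i, j) \<noteq> 0" by blast
  have "degree (S $$ (i, j)) < d i"
    using S0[OF ij(1,2), of "degree (S $$ (i, j))"] ij(3) by (meson leading_coeff_0_iff not_le)
  then have "P (d i - 1 - degree (S $$ (i, j)))"
    unfolding P_def using ij by (intro exI[of _ i] conjI exI[of _ j]) auto
  then have P: "P (LEAST t. P t)" by (rule LeastI)
  define t0 where "t0 = (LEAST t. P t)"
  have min: "\<not> P t" if "t < t0" for t using that not_less_Least by (auto simp: t0_def)
  obtain i j where ij: "i < k" "j < k" "t0 < d i" "coeff (S $$ (i, j)) (d i - 1 - t0) \<noteq> 0"
    using P unfolding P_def t0_def by blast
  define S1 where "S1 = monom 1 t0 \<cdot>\<^sub>m S"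
  have S1: "S1 \<in> carrier_mat k k" using S by (simp add: S1_def)
  have S1_low: "coeff (S1 $$ (i', j')) t = 0" if "i' < k" "j' < k" "t \<ge> d i'" for i' j' t
  proof (cases "t - t0 \<ge> d i' \<or> t < t0")
    case True
    then show ?thesis using that S(1) S0[of i' j' "t - t0"] by (auto simp: S1_def coeff_monom_mult)
  next
    case False
    \<comment> \<open>A nonzero coefficient pushed to degree \<open>t\<close>, at or beyond the
      bound, would have been at the top degree already after the smaller shift
      \<open>u\<close>.\<close>
    define u where "u = t0 - (t - d i') - 1"
    have "u < t0" "u < d i'" "d i' - 1 - u = t - t0" using False that by (auto simp: u_def)
    then have "coeff (S $$ (i', j')) (t - t0) = 0" using min[of u] that unfolding P_def by metis
    then show ?thesis using that S(1) by (auto simp: S1_def coeff_monom_mult)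
  qed
  define c where "c = coeff (S1 $$ (i, j)) (d i - 1)"
  have "c = coeff (S $$ (i, j)) (d i - 1 - t0)"
    using ij S(1) by (simp add: c_def S1_def coeff_monom_mult)
  then have c: "c \<noteq> 0" using ij by simp
  define Y1 where "Y1 = monom 1 t0 \<cdot>\<^sub>m Y"
  have Y1: "Y1 \<in> carrier_mat k k" using Y by (simp add: Y1_def)
  have eq1: "monom 1 m \<cdot>\<^sub>m S1 = U * Y1"
    unfolding S1_def Y1_def smult_mult_mat(1)[OF U Y, symmetric] eq[symmetric]
    by (simp add: smult_smult_mat mult.commute)
  have "spanning_degrees k U (d(i := d i - 1))"
    unfolding spanning_degrees_def
  proof (intro ballI allI)
    fix X :: "'a poly mat" and n assume X: "X \<in> carrier_mat k k"
    with d obtain e R Z where R: "R \<in> carrier_mat k k" "row_degrees_below d R"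
      and Z: "Z \<in> carrier_mat k k" and eq2: "monom 1 e \<cdot>\<^sub>m X = monom 1 (e + n) \<cdot>\<^sub>m R + U * Z"
      unfolding spanning_degrees_def by blast
    \<comment> \<open>Column \<open>j\<close> of \<open>S1\<close> is the pivot, with top
      coefficient \<open>c\<close> in row \<open>i\<close>. Subtracting \<open>S1 * E\<close>
      cancels row \<open>i\<close> of \<open>R\<close> at degree \<open>d i - 1\<close>, while the
      other rows keep their bounds.\<close>
    define E where "E = mat k k (\<lambda>(i', j'). if i' = j then [:coeff (R $$ (i, j')) (d i - 1) / c:] else 0)"
    have E: "E \<in> carrier_mat k k" by (simp add: E_def)
    have S1E: "S1 * E \<in> carrier_mat k k" using S1 E by simp
    have ent: "(S1 * E) $$ (i', j') = smult (coeff (R $$ (i, j')) (d i - 1) / c) (S1 $$ (i', j))"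
      if "i' < k" "j' < k" for i' j'
    proof -
      have "(S1 * E) $$ (i', j') = (\<Sum>l<k. S1 $$ (i', l) * E $$ (l, j'))"
        by (rule mult_mat_index[OF S1 E that])
      also have "\<dots> = (\<Sum>l<k. if l = j then S1 $$ (i', j) * E $$ (j, j') else 0)"
        by (rule sum.cong) (use that in \<open>auto simp: E_def\<close>)
      finally show ?thesis using that ij by (simp add: E_def)
    qed
    define R' where "R' = R - S1 * E"
    have R': "R' \<in> carrier_mat k k" unfolding R'_def by (rule minus_carrier_mat[OF S1E])
    have "row_degrees_below (d(i := d i - 1)) R'"
      unfolding row_degrees_below_def
    proof (intro allI impI)
      fix i' j' t
      assume "i' < dim_row R'" "j' < dim_col R'" and t: "(d(i := d i - 1)) i' \<le> t"
      then have l: "i' < k" "j' < k" using R' by auto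
      have *: "coeff (R' $$ (i', j')) t = coeff (R $$ (i', j')) t
           - coeff (R $$ (i, j')) (d i - 1) / c * coeff (S1 $$ (i', j)) t"
        using l R(1) S1 E ent[OF l] by (simp add: R'_def del: index_mult_mat(1))
      show "coeff (R' $$ (i', j')) t = 0"
      proof (cases "d i' \<le> t")
        case True
        then show ?thesis unfolding * using S1_low[OF l(1) ij(2) True] R l
          by (auto simp: row_degrees_below_def)
      next
        case False
        with t have "i' = i" "t = d i - 1" by (auto split: if_splits)
        then show ?thesis unfolding * using c by (simp add: c_def)
      qed
    qed
    \<comment> \<open>The additional exponent \<open>m\<close> clears the denominator: only
      \<open>D ^ m S1\<close> is known to be a multiple of \<open>U\<close>.\<close>
    moreover have "monom 1 (e + m) \<cdot>\<^sub>m X =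
        monom 1 (e + m + n) \<cdot>\<^sub>m R' + U * (monom 1 m \<cdot>\<^sub>m Z + monom 1 (e + n) \<cdot>\<^sub>m (Y1 * E))"
    proof -
      have ZY: "Z \<in> carrier_mat k k" "Y1 * E \<in> carrier_mat k k" using Z Y1 E by auto
      have UZ: "U * Z \<in> carrier_mat k k" "U * (Y1 * E) \<in> carrier_mat k k" using U ZY by auto
      have "U * (monom 1 m \<cdot>\<^sub>m Z + monom 1 (e + n) \<cdot>\<^sub>m (Y1 * E)) =
          monom 1 m \<cdot>\<^sub>m (U * Z) + monom 1 (e + n) \<cdot>\<^sub>m (U * (Y1 * E))"
        using mult_add_distrib_mat[OF U, of "monom 1 m \<cdot>\<^sub>m Z" k "monom 1 (e + n) \<cdot>\<^sub>m (Y1 * E)"]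
          mult_smult_distrib[OF U ZY(1)] mult_smult_distrib[OF U ZY(2)] ZY by simp
      also have "U * (Y1 * E) = (monom 1 m \<cdot>\<^sub>m S1) * E"
        unfolding eq1 by (rule assoc_mult_mat[symmetric, OF U Y1 E])
      also have "\<dots> = monom 1 m \<cdot>\<^sub>m (S1 * E)"
        by (rule smult_mult_mat(2)[symmetric, OF S1 E])
      finally have 1: "U * (monom 1 m \<cdot>\<^sub>m Z + monom 1 (e + n) \<cdot>\<^sub>m (Y1 * E)) =
        monom 1 m \<cdot>\<^sub>m (U * Z) + monom 1 (e + n) \<cdot>\<^sub>m (monom 1 m \<cdot>\<^sub>m (S1 * E))" .
      have 2: "monom 1 (e + m) \<cdot>\<^sub>m X = monom 1 m \<cdot>\<^sub>m (monom 1 e \<cdot>\<^sub>m X)"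
        by (simp add: smult_smult_mat mult_monom add.commute)
      have dims: "dim_row (U * Z) = k" "dim_col (U * Z) = k" "dim_row (S1 * E) = k"
        "dim_col (S1 * E) = k" using UZ S1E by auto
      show ?thesis unfolding 1 2 eq2 R'_def unfolding monom_1_add
        by (rule eq_matI)
          (use R dims in \<open>simp_all del: index_mult_mat add: algebra_simps\<close>)
    qed
    ultimately show "\<exists>e. \<exists>S\<in>carrier_mat k k. \<exists>Y\<in>carrier_mat k k.
        row_degrees_below (d(i := d i - 1)) S \<and> monom 1 e \<cdot>\<^sub>m X = monom 1 (e + n) \<cdot>\<^sub>m S + U * Y"
      using R' Z Y1 E
      by (intro exI[of _ "e + m"] bexI[of _ R']
          bexI[of _ "monom 1 m \<cdot>\<^sub>m Z + monom 1 (e + n) \<cdot>\<^sub>m (Y1 * E)"]) auto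
  qed
  then show thesis using that ij by (metis not_less_zero gr_zeroI)
qed

text \<open>A spanning degree vector of least sum is also independent, because a nonzero
  representative of zero would allow a decrease.\<close>

lemma basis_degrees_exist:
  fixes U :: "'a::field_gcd poly mat"
  assumes U: "U \<in> carrier_mat k k" and det: "det U \<noteq> 0"
  obtains d where "spanning_degrees k U d"
    "\<And>S Y m. S \<in> carrier_mat k k \<Longrightarrow> row_degrees_below d S \<Longrightarrow> Y \<in> carrier_mat k k \<Longrightarrow>
       monom 1 m \<cdot>\<^sub>m S = U * Y \<Longrightarrow> S = 0\<^sub>m k k"
proof -
  obtain d0 where "spanning_degrees k U d0" using spanning_degrees_exist[OF assms] by blast
  from ex_has_least_nat[of "spanning_degrees k U", OF this, of "\<lambda>d. \<Sum>i<k. d i"]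
  obtain d where d: "spanning_degrees k U d"
    and min: "\<And>d'. spanning_degrees k U d' \<Longrightarrow> (\<Sum>i<k. d i) \<le> (\<Sum>i<k. d' i)" by blast
  have "S = 0\<^sub>m k k" if S: "S \<in> carrier_mat k k" "row_degrees_below d S" "Y \<in> carrier_mat k k"
    "monom 1 m \<cdot>\<^sub>m S = U * Y" for S Y m
  proof (rule ccontr)
    assume "S \<noteq> 0\<^sub>m k k"
    from spanning_degrees_decrease[OF U d S(1,2) this S(3,4)] obtain i where
      i: "i < k" "d i > 0" "spanning_degrees k U (d(i := d i - 1))" by blast
    have "(\<Sum>j<k. (d(i := d i - 1)) j) < (\<Sum>j<k. d j)"
      by (rule sum_strict_mono_ex1) (use i in auto)
    then show False using min[OF i(3)] by simp
  qed
  with d that show thesis by blast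
qed

section \<open>Reduction modulo a nilpotent element\<close>

text \<open>A unit constant term makes \<open>f\<close> invertible as a power series, hence modulo
  every power of \<open>D\<close>.\<close>

lemma monom_1_dvd_cancel:
  fixes f g :: "'a::comm_ring_1 poly"
  assumes f: "coeff f 0 * b = 1" and dvd: "monom 1 n dvd f * g"
  shows "monom 1 n dvd g"
proof -
  have fg: "coeff (f * g) t = 0" if "t < n" for t using dvd that by (simp add: monom_1_dvd_iff')
  have "coeff g t = 0" if "t < n" for t
    using that
  proof (induction t rule: less_induct)
    case (less t)
    have "coeff (f * g) t = (\<Sum>i\<in>{0}. coeff f i * coeff g (t - i))"
      unfolding coeff_mult by (rule sum.mono_neutral_right) (use less in auto)
    then have "b * (coeff f 0 * coeff g t) = 0" using fg[OF less.prems] by simp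
    also have "b * (coeff f 0 * coeff g t) = (coeff f 0 * b) * coeff g t" by (simp add: ac_simps)
    finally show ?case using f by simp
  qed
  then show ?thesis by (simp add: monom_1_dvd_iff')
qed

lemma const_dvd_poly_iff:
  fixes p :: "'a::comm_ring_1 poly"
  shows "[:c:] dvd p \<longleftrightarrow> (\<forall>n. c dvd coeff p n)"
proof
  assume "\<forall>n. c dvd coeff p n"
  then show "[:c:] dvd p"
  proof (induction p)
    case (pCons a p)
    from pCons.prems have "c dvd a" "\<forall>n. c dvd coeff p n"
      by (metis coeff_pCons_0, metis coeff_pCons_Suc)
    with pCons.IH obtain b q where "a = c * b" "p = [:c:] * q" by (auto elim!: dvdE)
    then have "pCons a p = [:c:] * pCons b q" by simp
    then show ?case by (rule dvdI)
  qed simp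
qed (auto elim!: dvdE)

lemma monom_1_mult_cancel:
  fixes f g :: "'a::comm_ring_1 poly"
  assumes "monom 1 n * f = monom 1 n * g"
  shows "f = g"
proof (rule poly_eqI)
  fix t
  show "coeff f t = coeff g t"
    using arg_cong[OF assms, of "\<lambda>p. coeff p (n + t)"] by (simp add: coeff_monom_mult)
qed

lemma smult_monom_mat_cancel:
  fixes A B :: "'a::comm_ring_1 poly mat"
  assumes "monom 1 n \<cdot>\<^sub>m A = monom 1 n \<cdot>\<^sub>m B" "A \<in> carrier_mat m l" "B \<in> carrier_mat m l"
  shows "A = B"
proof (rule eq_matI)
  fix i j assume "i < dim_row B" "j < dim_col B"
  then have "monom 1 n * A $$ (i, j) = monom 1 n * B $$ (i, j)"
    using arg_cong[OF assms(1), of "\<lambda>M. M $$ (i, j)"] assms(2,3) by simp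
  then show "A $$ (i, j) = B $$ (i, j)" by (rule monom_1_mult_cancel)
qed (use assms(2,3) in auto)

lemma right_factor_det_nonzero:
  fixes U :: "'a::idom mat"
  assumes U: "U \<in> carrier_mat k k" and det: "det U \<noteq> 0"
    and A: "A \<in> carrier_mat k k" and eq: "U * A = c \<cdot>\<^sub>m U"
  shows "A = c \<cdot>\<^sub>m 1\<^sub>m k"
proof (rule eq_matI)
  note adj = adj_mat[OF U]
  have "det U \<cdot>\<^sub>m A = (adj_mat U * U) * A"
    using adj(3) mult_smult_assoc_mat[OF one_carrier_mat A, of "det U"] A by simp
  also have "\<dots> = adj_mat U * (c \<cdot>\<^sub>m U)"
    using assoc_mult_mat[OF adj(1) U A] eq by simp
  also have "\<dots> = c \<cdot>\<^sub>m (det U \<cdot>\<^sub>m 1\<^sub>m k)" using mult_smult_distrib[OF adj(1) U] adj(3) by simp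
  finally have *: "det U \<cdot>\<^sub>m A = c \<cdot>\<^sub>m (det U \<cdot>\<^sub>m 1\<^sub>m k)" .
  fix i j assume "i < dim_row (c \<cdot>\<^sub>m 1\<^sub>m k)" "j < dim_col (c \<cdot>\<^sub>m 1\<^sub>m k)"
  then have ij: "i < k" "j < k" by auto
  then have "det U * A $$ (i, j) = det U * (c \<cdot>\<^sub>m 1\<^sub>m k) $$ (i, j)"
    using arg_cong[OF *, of "\<lambda>M. M $$ (i, j)"] A by (simp add: ac_simps)
  then show "A $$ (i, j) = (c \<cdot>\<^sub>m 1\<^sub>m k) $$ (i, j)" using det by simp
qed (use A in auto)

text \<open>The model is reduction from the integers modulo \<open>p ^ r\<close> to the residue
  field, with \<open>\<pi>\<close> the image of \<open>p\<close>. By \<open>annihilator\<close>,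
  multiplication by \<open>\<pi> ^ (r - 1)\<close> turns congruences modulo \<open>\<pi>\<close>
  into equations. Since \<open>\<pi> ^ 0\<close> is nonzero, \<open>nilpotent\<close> forces
  \<open>r > 0\<close>.\<close>

locale nilpotent_reduction = comm_ring_hom red
  for red :: "'a::comm_ring_1 \<Rightarrow> 'b::field_gcd" +
  fixes \<pi> :: 'a and r :: nat
  assumes surj_red: "surj red"
    and red_eq_0_iff: "red a = 0 \<longleftrightarrow> \<pi> dvd a"
    and annihilator: "\<pi> ^ (r - 1) * a = 0 \<longleftrightarrow> \<pi> dvd a"
    and nilpotent: "\<pi> ^ r = 0"
begin

sublocale redp: map_poly_comm_ring_hom red ..

abbreviation redm :: "'a poly mat \<Rightarrow> 'b poly mat" where "redm \<equiv> map_mat (map_poly red)"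

text \<open>Lifting the inverse gives \<open>a * b0 = 1 - \<pi> z\<close>, which a finite geometric
  series inverts.\<close>

lemma unit_of_red_nonzero:
  assumes "red a \<noteq> 0"
  obtains b where "a * b = 1"
proof -
  obtain b0 where "red b0 = inverse (red a)" using surj_red by (metis surjD)
  then have "red (1 - a * b0) = 0" using assms by (simp add: hom_distribs)
  then obtain z where z: "1 - a * b0 = \<pi> * z" using red_eq_0_iff by (auto elim: dvdE)
  have "1 - \<pi> * z dvd 1 - (\<pi> * z) ^ r"
    using power_diff_sumr2[of 1 r "\<pi> * z"] by simp
  moreover have "1 - \<pi> * z = a * b0" using z by (simp add: algebra_simps)
  moreover have "(\<pi> * z) ^ r = 0" using nilpotent by (simp add: power_mult_distrib)
  ultimately have "a * b0 dvd 1" by simp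
  then show thesis using that by (metis dvdE mult.assoc)
qed

lemma redp_eq_0_iff: "map_poly red f = 0 \<longleftrightarrow> [:\<pi>:] dvd f"
  by (simp add: const_dvd_poly_iff poly_eq_iff red_eq_0_iff)

lemma redp_nilpotent: "[:\<pi>:] ^ r = 0"
  using nilpotent by (simp add: poly_const_pow)

lemma redp_annihilator: "smult (\<pi> ^ (r - 1)) f = 0 \<longleftrightarrow> map_poly red f = 0"
  by (simp add: poly_eq_iff annihilator red_eq_0_iff del: One_nat_def)

text \<open>A set-theoretic section of the reduction. Zero goes to zero so that row degree bounds
  survive lifting.\<close>

definition lift_poly :: "'b poly \<Rightarrow> 'a poly" where
  "lift_poly = map_poly (\<lambda>b. if b = 0 then 0 else inv_into UNIV red b)"

lemma redp_lift_poly [simp]: "map_poly red (lift_poly g) = g"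
  using surj_f_inv_f[OF surj_red] by (auto simp: poly_eq_iff lift_poly_def coeff_map_poly)

lemma coeff_lift_poly: "coeff g t = 0 \<Longrightarrow> coeff (lift_poly g) t = 0"
  by (simp add: lift_poly_def coeff_map_poly)

lemma redm_lift_mat: "redm (map_mat lift_poly M) = M"
  by (rule eq_matI) auto

lemma redm_eq:
  assumes "A \<in> carrier_mat m l" "B \<in> carrier_mat m l" "redm A = redm B"
  obtains Z where "Z \<in> carrier_mat m l" "A = B + [:\<pi>:] \<cdot>\<^sub>m Z"
proof -
  have "\<exists>z. A $$ (i, j) - B $$ (i, j) = [:\<pi>:] * z" if "i < m" "j < l" for i j
  proof -
    have "map_poly red (A $$ (i, j) - B $$ (i, j)) = 0"
      using arg_cong[OF assms(3), of "\<lambda>M. M $$ (i, j)"] that assms(1,2) by (simp add: hom_distribs)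
    then show ?thesis by (simp add: redp_eq_0_iff dvd_def)
  qed
  then obtain z where z: "\<And>i j. i < m \<Longrightarrow> j < l \<Longrightarrow> A $$ (i, j) - B $$ (i, j) = [:\<pi>:] * z i j" by metis
  show thesis
  proof (rule that[of "mat m l (\<lambda>(i, j). z i j)"])
    show "A = B + [:\<pi>:] \<cdot>\<^sub>m mat m l (\<lambda>(i, j). z i j)"
      by (rule eq_matI) (use assms z[symmetric] in auto)
  qed simp
qed

text \<open>\<open>x = D ^ s - \<pi> z\<close> divides \<open>D ^ (s r) - (\<pi> z) ^ r\<close>,
  where the second power vanishes.\<close>

lemma monom_of_redp_monom:
  assumes "map_poly red x = monom 1 s"
  obtains y where "x * y = monom 1 (s * r)"
proof -
  have "map_poly red (monom 1 s - x) = 0" using assms by (simp add: hom_distribs map_poly_monom)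
  then obtain z where z: "monom 1 s - x = [:\<pi>:] * z" using redp_eq_0_iff by (auto elim: dvdE)
  have "monom 1 s - [:\<pi>:] * z dvd monom 1 s ^ r - ([:\<pi>:] * z) ^ r"
    using power_diff_sumr2[of "monom 1 s" r "[:\<pi>:] * z"] by simp
  also have "\<dots> = monom 1 (s * r)" unfolding power_mult_distrib redp_nilpotent by (simp add: monom_power)
  moreover have "monom 1 s - [:\<pi>:] * z = x" unfolding z[symmetric] by simp
  ultimately have "x dvd monom 1 (s * r)" by simp
  then show thesis using that by (metis dvdE)
qed

text \<open>Since \<open>red\<close> is surjective, the right factor ideal reduces to an ideal. This
  contains the reduced minors and, by Bezout, their gcd \<open>D ^ s\<close>. A preimage of
  \<open>D ^ s\<close> divides a power of \<open>D\<close>, which therefore lies in the right factor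
  ideal itself.\<close>

lemma right_factor_of_Gcd_minors:
  assumes G: "G \<in> carrier_mat k n" and Gcd: "Gcd (full_minors (redm G)) = monom 1 s"
  obtains Q m where "Q \<in> carrier_mat n k" "G * Q = monom 1 m \<cdot>\<^sub>m 1\<^sub>m k"
proof -
  let ?I = "right_factor_ideal k n G"
  note I = is_ideal_right_factor_ideal[OF G]
  have "is_ideal (map_poly red ` ?I)"
    unfolding is_ideal_def
  proof (intro conjI ballI allI)
    show "0 \<in> map_poly red ` ?I" using is_ideal_0[OF I] by (intro image_eqI[of _ _ 0]) auto
  next
    fix a b assume "a \<in> map_poly red ` ?I" "b \<in> map_poly red ` ?I"
    then obtain x y where "a = map_poly red x" "x \<in> ?I" "b = map_poly red y" "y \<in> ?I" by blast
    then show "a + b \<in> map_poly red ` ?I"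
      by (intro image_eqI[of _ _ "x + y"]) (auto simp: hom_distribs intro: is_ideal_add[OF I])
  next
    fix a c assume "a \<in> map_poly red ` ?I"
    then obtain x where "a = map_poly red x" "x \<in> ?I" by blast
    then show "c * a \<in> map_poly red ` ?I"
      by (intro image_eqI[of _ _ "lift_poly c * x"]) (auto simp: hom_distribs intro: is_ideal_mult[OF I])
  qed
  moreover have "full_minors (redm G) \<subseteq> map_poly red ` ?I"
    unfolding full_minors_hom[OF G] using full_minors_right_factor_ideal[OF G] by blast
  ultimately have "Gcd (full_minors (redm G)) \<in> map_poly red ` ?I"
    by (intro is_ideal_Gcd finite_full_minors)
  then obtain x where x: "x \<in> ?I" "map_poly red x = monom 1 s" unfolding Gcd by (metis imageE)
  obtain y where "x * y = monom 1 (s * r)" using monom_of_redp_monom[OF x(2)] .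
  then have "monom 1 (s * r) \<in> ?I" using is_ideal_mult'[OF I x(1), of y] by simp
  then show thesis using that unfolding right_factor_ideal_def by blast
qed

section \<open>Lifting representatives from the residue field\<close>

lemma redm_add:
  assumes "A \<in> carrier_mat m l" "B \<in> carrier_mat m l"
  shows "redm (A + B) = redm A + redm B"
  by (rule eq_matI) (use assms in \<open>auto simp: hom_distribs\<close>)

lemma redm_minus:
  assumes "A \<in> carrier_mat m l" "B \<in> carrier_mat m l"
  shows "redm (A - B) = redm A - redm B"
  by (rule eq_matI) (use assms in \<open>auto simp: hom_distribs\<close>)

lemma redm_smult_monom: "redm (monom 1 t \<cdot>\<^sub>m M) = monom 1 t \<cdot>\<^sub>m redm M"
  by (rule eq_matI) (auto simp: hom_distribs map_poly_monom)

text \<open>The representation over the residue field is lifted entrywise; the lifts satisfy it up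
  to a multiple of \<open>\<pi>\<close>.\<close>

lemma spanning_step:
  assumes U: "U \<in> carrier_mat k k" and d: "spanning_degrees k (redm U) d"
    and X: "X \<in> carrier_mat k k"
  shows "\<exists>e. \<exists>S\<in>carrier_mat k k. \<exists>Y\<in>carrier_mat k k. \<exists>Z\<in>carrier_mat k k. row_degrees_below d S \<and>
    monom 1 e \<cdot>\<^sub>m X = monom 1 (e + m) \<cdot>\<^sub>m S + U * Y + [:\<pi>:] \<cdot>\<^sub>m Z"
proof -
  have "redm X \<in> carrier_mat k k" using X by simp
  with d obtain e S0 Y0 where S0: "S0 \<in> carrier_mat k k" "row_degrees_below d S0"
    and Y0: "Y0 \<in> carrier_mat k k"
    and eq: "monom 1 e \<cdot>\<^sub>m redm X = monom 1 (e + m) \<cdot>\<^sub>m S0 + redm U * Y0"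
    unfolding spanning_degrees_def by blast
  define S where "S = map_mat lift_poly S0"
  define Y where "Y = map_mat lift_poly Y0"
  have S: "S \<in> carrier_mat k k" and Y: "Y \<in> carrier_mat k k" using S0 Y0 by (auto simp: S_def Y_def)
  have low: "row_degrees_below d S"
    using S0 by (auto simp: row_degrees_below_def S_def intro: coeff_lift_poly)
  have UY: "U * Y \<in> carrier_mat k k" using U Y by simp
  have "redm (monom 1 e \<cdot>\<^sub>m X) = monom 1 (e + m) \<cdot>\<^sub>m redm S + redm U * redm Y"
    unfolding redm_smult_monom eq by (simp add: S_def Y_def redm_lift_mat)
  also have "\<dots> = redm (monom 1 (e + m) \<cdot>\<^sub>m S + U * Y)"
    using redm_add[OF smult_carrier_mat[OF S] UY] redp.mat_hom_mult[OF U Y]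
    by (simp add: redm_smult_monom)
  finally show ?thesis
    using redm_eq[of "monom 1 e \<cdot>\<^sub>m X" k k "monom 1 (e + m) \<cdot>\<^sub>m S + U * Y"] S Y X UY low
    by (metis add_carrier_mat smult_carrier_mat)
qed

text \<open>Nakayama's lemma for the nilpotent ideal generated by \<open>\<pi>\<close>.\<close>

lemma spanning_lift:
  assumes U: "U \<in> carrier_mat k k" and d: "spanning_degrees k (redm U) d"
    and X: "X \<in> carrier_mat k k"
  shows "\<exists>e. \<exists>S\<in>carrier_mat k k. \<exists>Y\<in>carrier_mat k k. \<exists>Z\<in>carrier_mat k k. row_degrees_below d S \<and>
    monom 1 e \<cdot>\<^sub>m X = monom 1 e \<cdot>\<^sub>m S + U * Y + [:\<pi>:] ^ j \<cdot>\<^sub>m Z"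
proof (induction j)
  case 0
  have "monom 1 0 \<cdot>\<^sub>m X = monom 1 0 \<cdot>\<^sub>m 0\<^sub>m k k + U * 0\<^sub>m k k + [:\<pi>:] ^ 0 \<cdot>\<^sub>m X"
    using X right_mult_zero_mat[OF U, of k] by (intro eq_matI) auto
  moreover have "row_degrees_below d (0\<^sub>m k k :: 'a poly mat)" by (simp add: row_degrees_below_def)
  ultimately show ?case using X zero_carrier_mat by blast
next
  case (Suc j)
  then obtain e S Y Z where S: "S \<in> carrier_mat k k" "row_degrees_below d S"
    and Y: "Y \<in> carrier_mat k k" and Z: "Z \<in> carrier_mat k k"
    and eq: "monom 1 e \<cdot>\<^sub>m X = monom 1 e \<cdot>\<^sub>m S + U * Y + [:\<pi>:] ^ j \<cdot>\<^sub>m Z" by blast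
  \<comment> \<open>With the parameter \<open>e\<close>, the representative of the error
    \<open>Z\<close> carries the factor \<open>D ^ (e' + e)\<close>, the same as \<open>S\<close>
    after multiplication by \<open>D ^ e'\<close>, so the two merge.\<close>
  from spanning_step[OF U d Z, of e] obtain e' S' Y' Z' where
    S': "S' \<in> carrier_mat k k" "row_degrees_below d S'"
    and Y': "Y' \<in> carrier_mat k k" and Z': "Z' \<in> carrier_mat k k"
    and eq': "monom 1 e' \<cdot>\<^sub>m Z = monom 1 (e' + e) \<cdot>\<^sub>m S' + U * Y' + [:\<pi>:] \<cdot>\<^sub>m Z'" by blast
  define S'' where "S'' = S + [:\<pi>:] ^ j \<cdot>\<^sub>m S'"
  define Y'' where "Y'' = monom 1 e' \<cdot>\<^sub>m Y + [:\<pi>:] ^ j \<cdot>\<^sub>m Y'"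
  have S'': "S'' \<in> carrier_mat k k" and Y'': "Y'' \<in> carrier_mat k k"
    using S S' Y Y' by (auto simp: S''_def Y''_def)
  have "row_degrees_below d S''"
    using S S' by (auto simp: row_degrees_below_def S''_def poly_const_pow)
  moreover have "monom 1 (e' + e) \<cdot>\<^sub>m X = monom 1 (e' + e) \<cdot>\<^sub>m S'' + U * Y'' + [:\<pi>:] ^ Suc j \<cdot>\<^sub>m Z'"
  proof -
    have UY: "U * Y \<in> carrier_mat k k" "U * Y' \<in> carrier_mat k k" using U Y Y' by auto
    have 1: "U * Y'' = monom 1 e' \<cdot>\<^sub>m (U * Y) + [:\<pi>:] ^ j \<cdot>\<^sub>m (U * Y')"
      unfolding Y''_def
      using mult_add_distrib_mat[OF U, of "monom 1 e' \<cdot>\<^sub>m Y" k "[:\<pi>:] ^ j \<cdot>\<^sub>m Y'"]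
        mult_smult_distrib[OF U Y] mult_smult_distrib[OF U Y'] Y Y' by simp
    have dims: "dim_row (U * Y) = k" "dim_col (U * Y) = k" "dim_row (U * Y') = k" "dim_col (U * Y') = k"
      using UY by auto
    have ent: "monom 1 e' * Z $$ (a, b) =
        monom 1 (e' + e) * S' $$ (a, b) + (U * Y') $$ (a, b) + [:\<pi>:] * Z' $$ (a, b)"
      "monom 1 e * X $$ (a, b) = monom 1 e * S $$ (a, b) + (U * Y) $$ (a, b) + [:\<pi>:] ^ j * Z $$ (a, b)"
      if "a < k" "b < k" for a b
      using arg_cong[OF eq', of "\<lambda>M. M $$ (a, b)"] arg_cong[OF eq, of "\<lambda>M. M $$ (a, b)"]
        that S Z X S' Z' dims by (simp_all del: index_mult_mat)
    show ?thesis
      unfolding 1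
    proof (rule eq_matI)
      fix a b
      assume "a < dim_row (monom 1 (e' + e) \<cdot>\<^sub>m S'' + (monom 1 e' \<cdot>\<^sub>m (U * Y) + [:\<pi>:] ^ j \<cdot>\<^sub>m (U * Y')) +
          [:\<pi>:] ^ Suc j \<cdot>\<^sub>m Z')"
        "b < dim_col (monom 1 (e' + e) \<cdot>\<^sub>m S'' + (monom 1 e' \<cdot>\<^sub>m (U * Y) + [:\<pi>:] ^ j \<cdot>\<^sub>m (U * Y')) +
          [:\<pi>:] ^ Suc j \<cdot>\<^sub>m Z')"
      then have ab: "a < k" "b < k" using Z' by auto
      have "monom 1 (e' + e) * X $$ (a, b) = monom 1 e' * (monom 1 e * X $$ (a, b))"
        by (simp add: monom_1_add mult.assoc)
      also have "\<dots> = monom 1 e' * (monom 1 e * S $$ (a, b) + (U * Y) $$ (a, b)) +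
          [:\<pi>:] ^ j * (monom 1 e' * Z $$ (a, b))"
        unfolding ent(2)[OF ab] by (simp only: distrib_left mult.left_commute)
      also have "\<dots> = monom 1 (e' + e) * (S $$ (a, b) + [:\<pi>:] ^ j * S' $$ (a, b)) +
          (monom 1 e' * (U * Y) $$ (a, b) + [:\<pi>:] ^ j * (U * Y') $$ (a, b)) + [:\<pi>:] ^ Suc j * Z' $$ (a, b)"
        unfolding ent(1)[OF ab] monom_1_add power_Suc by (simp only: ring_distribs ac_simps)
      finally show "(monom 1 (e' + e) \<cdot>\<^sub>m X) $$ (a, b) = (monom 1 (e' + e) \<cdot>\<^sub>m S'' +
          (monom 1 e' \<cdot>\<^sub>m (U * Y) + [:\<pi>:] ^ j \<cdot>\<^sub>m (U * Y')) + [:\<pi>:] ^ Suc j \<cdot>\<^sub>m Z') $$ (a, b)"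
        using ab X S S' Z' dims by (simp add: S''_def del: index_mult_mat power_Suc)
    qed (use X Z' in auto)
  qed
  ultimately show ?case using S'' Y'' Z' by blast
qed

end

section \<open>Factorization over the Laurent polynomials\<close>

context nilpotent_reduction
begin

text \<open>The two equations say that \<open>U\<close> and the Hermite-like form \<open>B = monom_diag k d - S\<close> differ by a
  factor that is invertible over the Laurent polynomials.\<close>

lemma hermite_factor:
  assumes U: "U \<in> carrier_mat k k" and det: "det (redm U) \<noteq> 0"
  obtains d S V Y e m where "S \<in> carrier_mat k k" "row_degrees_below d S"
    "V \<in> carrier_mat k k" "Y \<in> carrier_mat k k"
    "(monom_diag k d - S) * V = monom 1 e \<cdot>\<^sub>m U"
    "monom 1 m \<cdot>\<^sub>m (monom_diag k d - S) = U * Y"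
    "red (coeff (det (monom_diag k d - S)) 0) \<noteq> 0"
proof -
  let ?U = "redm U"
  have rU: "?U \<in> carrier_mat k k" using U by simp
  obtain d where span: "spanning_degrees k ?U d"
    and indep: "\<And>S Y m. S \<in> carrier_mat k k \<Longrightarrow> row_degrees_below d S \<Longrightarrow> Y \<in> carrier_mat k k \<Longrightarrow>
       monom 1 m \<cdot>\<^sub>m S = ?U * Y \<Longrightarrow> S = 0\<^sub>m k k"
    using basis_degrees_exist[OF rU det] by blast
  \<comment> \<open>The monomials of degree \<open>d i\<close>, the first ones outside the bounds,
    are rewritten by lower ones; at precision \<open>r\<close> the error term vanishes.\<close>
  from spanning_lift[OF U span monom_diag_carrier, of d r]
  obtain m S Y Z where S: "S \<in> carrier_mat k k" "row_degrees_below d S"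
    and Y: "Y \<in> carrier_mat k k" and Z: "Z \<in> carrier_mat k k"
    and eq: "monom 1 m \<cdot>\<^sub>m monom_diag k d = monom 1 m \<cdot>\<^sub>m S + U * Y + [:\<pi>:] ^ r \<cdot>\<^sub>m Z" by blast
  define B where "B = monom_diag k d - S"
  have B: "B \<in> carrier_mat k k" unfolding B_def by (rule minus_carrier_mat[OF S(1)])
  have UY: "U * Y \<in> carrier_mat k k" using U Y by simp
  have BUY: "monom 1 m \<cdot>\<^sub>m B = U * Y"
  proof (rule eq_matI)
    fix i j assume "i < dim_row (U * Y)" "j < dim_col (U * Y)"
    then have ij: "i < k" "j < k" using UY by auto
    have dims: "dim_row (U * Y) = k" "dim_col (U * Y) = k" using UY by auto
    have "monom 1 m * monom_diag k d $$ (i, j) = monom 1 m * S $$ (i, j) + (U * Y) $$ (i, j)"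
      using arg_cong[OF eq, of "\<lambda>M. M $$ (i, j)"] ij S Z dims redp_nilpotent
      by (simp del: index_mult_mat)
    then show "(monom 1 m \<cdot>\<^sub>m B) $$ (i, j) = (U * Y) $$ (i, j)"
      using ij S dims
      by (simp del: index_mult_mat add: B_def algebra_simps)
  qed (use B UY in auto)
  let ?B = "redm B" and ?Y = "redm Y"
  have rB: "?B \<in> carrier_mat k k" and rY: "?Y \<in> carrier_mat k k" and rS: "redm S \<in> carrier_mat k k"
    using B Y S by auto
  have rBS: "?B = monom_diag k d - redm S"
    unfolding B_def redm_minus[OF monom_diag_carrier S(1)]
    by (rule arg_cong[of _ _ "\<lambda>M. M - _"], rule eq_matI) (auto simp: monom_diag_def map_poly_monom)
  have rlow: "row_degrees_below d (redm S)" using S by (auto simp: row_degrees_below_def)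
  have rBUY: "monom 1 m \<cdot>\<^sub>m ?B = ?U * ?Y"
    using arg_cong[OF BUY, of redm] by (simp add: redm_smult_monom redp.mat_hom_mult[OF U Y])
  \<comment> \<open>What lies in the column module of \<open>?U\<close> after inverting
    \<open>D\<close> is already a polynomial multiple of \<open>?B\<close>: the remainder of the
    division by \<open>?B\<close> lies in that module too and vanishes by independence.\<close>
  have factor: "\<exists>Q\<in>carrier_mat k k. W = ?B * Q"
    if W: "W \<in> carrier_mat k k" and T: "T \<in> carrier_mat k k" and WT: "monom 1 a \<cdot>\<^sub>m W = ?U * T" for W T a
  proof -
    from mat_division[OF rS rlow W] obtain Q R where Q: "Q \<in> carrier_mat k k"
      and R: "R \<in> carrier_mat k k" "row_degrees_below d R" and WQ: "W = ?B * Q + R"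
      unfolding rBS by blast
    have BQ: "?B * Q \<in> carrier_mat k k" using rB Q by simp
    have YQ: "?Y * Q \<in> carrier_mat k k" using rY Q by simp
    have UT: "?U * T \<in> carrier_mat k k" and UYQ: "?U * (?Y * Q) \<in> carrier_mat k k"
      using rU T YQ by auto
    define T' where "T' = monom 1 m \<cdot>\<^sub>m T - monom 1 a \<cdot>\<^sub>m (?Y * Q)"
    have T': "T' \<in> carrier_mat k k"
      unfolding T'_def by (rule minus_carrier_mat, rule smult_carrier_mat[OF YQ])
    have "monom 1 m \<cdot>\<^sub>m (?B * Q) = ?U * (?Y * Q)"
      unfolding smult_mult_mat(2)[OF rB Q] rBUY by (rule assoc_mult_mat[OF rU rY Q])
    then have 1: "monom 1 m * (?B * Q) $$ (i, j) = (?U * (?Y * Q)) $$ (i, j)"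
      if "i < k" "j < k" for i j
      using that arg_cong[of "monom 1 m \<cdot>\<^sub>m (?B * Q)" _ "\<lambda>M. M $$ (i, j)"] BQ
      by (metis carrier_matD index_smult_mat(1))
    have 2: "monom 1 a * W $$ (i, j) = (?U * T) $$ (i, j)" if "i < k" "j < k" for i j
      using that arg_cong[OF WT, of "\<lambda>M. M $$ (i, j)"] W
      by (metis carrier_matD index_smult_mat(1))
    have 3: "?U * T' = monom 1 m \<cdot>\<^sub>m (?U * T) - monom 1 a \<cdot>\<^sub>m (?U * (?Y * Q))"
      unfolding T'_def
      using mult_minus_distrib_mat[OF rU smult_carrier_mat[OF T] smult_carrier_mat[OF YQ]]
        mult_smult_distrib[OF rU T] mult_smult_distrib[OF rU YQ] by simp
    have "monom 1 (m + a) \<cdot>\<^sub>m R = ?U * T'"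
      unfolding 3
    proof (rule eq_matI)
      fix i j
      assume "i < dim_row (monom 1 m \<cdot>\<^sub>m (?U * T) - monom 1 a \<cdot>\<^sub>m (?U * (?Y * Q)))"
        "j < dim_col (monom 1 m \<cdot>\<^sub>m (?U * T) - monom 1 a \<cdot>\<^sub>m (?U * (?Y * Q)))"
      then have ij: "i < k" "j < k" using UYQ by auto
      have WR: "W $$ (i, j) = (?B * Q) $$ (i, j) + R $$ (i, j)"
        unfolding WQ using ij BQ R by (metis carrier_matD index_add_mat(1))
      have "monom 1 (m + a) * R $$ (i, j) =
          monom 1 m * (monom 1 a * W $$ (i, j)) - monom 1 a * (monom 1 m * (?B * Q) $$ (i, j))"
        unfolding monom_1_add WR by (simp add: algebra_simps del: index_mult_mat)
      also have "\<dots> = monom 1 m * (?U * T) $$ (i, j) - monom 1 a * (?U * (?Y * Q)) $$ (i, j)"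
        unfolding 1[OF ij] 2[OF ij] ..
      finally show "(monom 1 (m + a) \<cdot>\<^sub>m R) $$ (i, j) =
          (monom 1 m \<cdot>\<^sub>m (?U * T) - monom 1 a \<cdot>\<^sub>m (?U * (?Y * Q))) $$ (i, j)"
        using ij R UT UYQ carrier_matD[OF UT] carrier_matD[OF UYQ] by (simp del: index_mult_mat)
    qed (use R UYQ in auto)
    from indep[OF R T' this] have "R = 0\<^sub>m k k" .
    then have "W = ?B * Q" using WQ BQ by simp
    then show ?thesis using Q by blast
  qed
  have "monom 1 0 \<cdot>\<^sub>m ?U = ?U * 1\<^sub>m k"
    unfolding right_mult_one_mat[OF rU] by (rule eq_matI) auto
  from factor[OF rU one_carrier_mat this] obtain Q where Q: "Q \<in> carrier_mat k k" and UBQ: "?U = ?B * Q"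
    by blast
  \<comment> \<open>\<open>?U = ?B * Q\<close> together with \<open>rBUY\<close> gives
    \<open>?U * (?Y * Q) = D ^ m ?U\<close>, and \<open>?U\<close> cancels.\<close>
  have YQ: "?Y * Q = monom 1 m \<cdot>\<^sub>m 1\<^sub>m k"
  proof (rule right_factor_det_nonzero[OF rU det])
    show "?Y * Q \<in> carrier_mat k k" using rY Q by simp
    have "?U * (?Y * Q) = monom 1 m \<cdot>\<^sub>m (?B * Q)"
      unfolding smult_mult_mat(2)[OF rB Q] rBUY by (rule assoc_mult_mat[symmetric, OF rU rY Q])
    then show "?U * (?Y * Q) = monom 1 m \<cdot>\<^sub>m ?U" using UBQ by simp
  qed
  \<comment> \<open>\<open>det Y\<close> times a lift of \<open>det Q\<close> reduces to a power of
    \<open>D\<close>. Hence \<open>det Y\<close> divides a power of \<open>D\<close>, and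
    \<open>Y\<close> is invertible over the Laurent polynomials already before reduction.\<close>
  define v where "v = lift_poly (det Q)"
  have "map_poly red (det Y * v) = det ?Y * det Q"
    by (simp add: v_def hom_distribs)
  also have "\<dots> = det (?Y * Q)" by (rule det_mult[symmetric, OF rY Q])
  also have "\<dots> = monom 1 (m * k)" unfolding YQ by (simp add: det_smult monom_power)
  finally obtain y where y: "det Y * v * y = monom 1 (m * k * r)" by (rule monom_of_redp_monom)
  define Y' where "Y' = (v * y) \<cdot>\<^sub>m adj_mat Y"
  note adj = adj_mat[OF Y]
  have Y': "Y' \<in> carrier_mat k k" using adj by (simp add: Y'_def)
  have YY': "Y * Y' = monom 1 (m * k * r) \<cdot>\<^sub>m 1\<^sub>m k"
    unfolding Y'_def mult_smult_distrib[OF Y adj(1)] adj(2) smult_smult_mat y[symmetric]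
    by (simp add: ac_simps)
  have BV: "B * (monom 1 m \<cdot>\<^sub>m Y') = monom 1 (m * k * r) \<cdot>\<^sub>m U"
  proof -
    have "B * (monom 1 m \<cdot>\<^sub>m Y') = (monom 1 m \<cdot>\<^sub>m B) * Y'"
      using smult_mult_mat[OF B Y', of "monom 1 m"] by simp
    also have "\<dots> = U * (Y * Y')" unfolding BUY by (rule assoc_mult_mat[OF U Y Y'])
    also have "\<dots> = monom 1 (m * k * r) \<cdot>\<^sub>m U"
      unfolding YY' using mult_smult_distrib[OF U one_carrier_mat] U by simp
    finally show ?thesis .
  qed
  \<comment> \<open>Spanning with parameter 1 represents the identity by a multiple
    \<open>D R\<close>, so \<open>1 - D R\<close> is a multiple of \<open>?B\<close>; at
    \<open>D = 0\<close> its determinant is 1.\<close>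
  have "coeff (det ?B) 0 \<noteq> 0"
  proof -
    obtain e R T where R: "R \<in> carrier_mat k k" and T: "T \<in> carrier_mat k k"
      and eq: "monom 1 e \<cdot>\<^sub>m 1\<^sub>m k = monom 1 (e + 1) \<cdot>\<^sub>m R + ?U * T"
      using span one_carrier_mat unfolding spanning_degrees_def by blast
    define W where "W = 1\<^sub>m k - monom 1 1 \<cdot>\<^sub>m R"
    have W: "W \<in> carrier_mat k k" using R by (auto simp: W_def)
    have UT: "?U * T \<in> carrier_mat k k" using rU T by simp
    have "monom 1 e \<cdot>\<^sub>m W = ?U * T"
    proof (rule eq_matI)
      fix i j assume "i < dim_row (?U * T)" "j < dim_col (?U * T)"
      then have ij: "i < k" "j < k" using UT by auto
      have "monom 1 e * (1\<^sub>m k $$ (i, j)) = monom 1 (e + 1) * R $$ (i, j) + (?U * T) $$ (i, j)"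
        using arg_cong[OF eq, of "\<lambda>M. M $$ (i, j)"] ij R carrier_matD[OF UT]
        by (simp del: index_mult_mat index_one_mat(1))
      then show "(monom 1 e \<cdot>\<^sub>m W) $$ (i, j) = (?U * T) $$ (i, j)"
        using ij R unfolding W_def monom_1_add
        by (simp del: index_mult_mat index_one_mat(1) add: right_diff_distrib mult.assoc)
    qed (use W UT in auto)
    from factor[OF W T this] obtain Q' where Q': "Q' \<in> carrier_mat k k" "W = ?B * Q'" by blast
    have ev: "comm_ring_hom (\<lambda>p :: 'b poly. poly p 0)" by unfold_locales auto
    have "map_mat (\<lambda>p. poly p 0) W = 1\<^sub>m k"
      by (rule eq_matI) (use R in \<open>auto simp: W_def poly_monom\<close>)
    then have "poly (det W) 0 = 1" using comm_ring_hom.hom_det[OF ev, of W] by simp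
    moreover have "det W = det ?B * det Q'" unfolding Q'(2) by (rule det_mult[OF rB Q'(1)])
    ultimately show ?thesis by (auto simp: poly_0_coeff_0 coeff_mult)
  qed
  then have "red (coeff (det B) 0) \<noteq> 0" by simp
  with S Y' Y BV BUY show thesis
    by (intro that[of S d "monom 1 m \<cdot>\<^sub>m Y'" Y]) (auto simp: B_def)
qed

text \<open>For \<open>B\<close> from \<open>hermite_factor\<close>, \<open>det B\<close> is monic
  of degree the sum of the \<open>d i\<close>. If the sum is 0, then \<open>B\<close> is the
  identity and \<open>U\<close> is invertible over the Laurent polynomials. Otherwise
  \<open>B * (V * G')\<close> is a power of \<open>D\<close> times \<open>G\<close>; that power
  divides \<open>V * G'\<close> because \<open>det B\<close> has a unit constant term, and the
  quotient is \<open>H\<close>.\<close>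

lemma reduce_or_invertible:
  assumes G: "G \<in> carrier_mat k n" and G': "G' \<in> carrier_mat k n"
    and U: "U \<in> carrier_mat k k" and eq: "monom 1 a \<cdot>\<^sub>m G = U * G'" and det: "det (redm U) \<noteq> 0"
  obtains (invertible) Y m where "Y \<in> carrier_mat k k" "U * Y = monom 1 m \<cdot>\<^sub>m 1\<^sub>m k"
  | (reduced) B H N where "B \<in> carrier_mat k k" "H \<in> carrier_mat k n" "G = B * H" "N > 0"
      "degree (det B) \<le> N" "coeff (det B) N = 1" "red (coeff (det B) 0) \<noteq> 0"
proof -
  obtain d S V Y e m where S: "S \<in> carrier_mat k k" "row_degrees_below d S"
    and V: "V \<in> carrier_mat k k" and Y: "Y \<in> carrier_mat k k"
    and BV: "(monom_diag k d - S) * V = monom 1 e \<cdot>\<^sub>m U"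
    and BUY: "monom 1 m \<cdot>\<^sub>m (monom_diag k d - S) = U * Y"
    and unit: "red (coeff (det (monom_diag k d - S)) 0) \<noteq> 0"
    by (rule hermite_factor[OF U det])
  show thesis
  proof (cases "(\<Sum>i<k. d i) = 0")
    case True
    have one: "monom_diag k d - S = 1\<^sub>m k"
      by (rule eq_matI) (use True S in \<open>auto simp: monom_diag_def row_degrees_below_def poly_eq_iff\<close>)
    show thesis by (rule invertible[OF Y, of m]) (simp add: BUY[symmetric] one)
  next
    case False
    define B where "B = monom_diag k d - S"
    have B: "B \<in> carrier_mat k k" unfolding B_def by (rule minus_carrier_mat[OF S(1)])
    define P where "P = V * G'"
    have P: "P \<in> carrier_mat k n" using V G' by (simp add: P_def)
    have BP: "B * P = monom 1 (e + a) \<cdot>\<^sub>m G"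
    proof -
      have "B * P = (monom 1 e \<cdot>\<^sub>m U) * G'"
        unfolding P_def BV[symmetric] B_def[symmetric] by (rule assoc_mult_mat[symmetric, OF B V G'])
      also have "\<dots> = monom 1 e \<cdot>\<^sub>m (monom 1 a \<cdot>\<^sub>m G)"
        unfolding eq by (rule mult_smult_assoc_mat[OF U G'])
      finally show ?thesis by (simp add: smult_smult_mat mult_monom)
    qed
    note adj = adj_mat[OF B]
    have "det B \<cdot>\<^sub>m P = adj_mat B * (B * P)"
      using assoc_mult_mat[OF adj(1) B P] adj(3) mult_smult_assoc_mat[OF one_carrier_mat P, of "det B"] P
      by simp
    also have "\<dots> = monom 1 (e + a) \<cdot>\<^sub>m (adj_mat B * G)"
      unfolding BP by (rule mult_smult_distrib[OF adj(1) G])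
    finally have detBP: "det B \<cdot>\<^sub>m P = monom 1 (e + a) \<cdot>\<^sub>m (adj_mat B * G)" .
    obtain b where b: "coeff (det B) 0 * b = 1"
      using unit_of_red_nonzero unit unfolding B_def by blast
    have "\<exists>h. P $$ (i, j) = monom 1 (e + a) * h" if "i < k" "j < n" for i j
    proof -
      have "det B * P $$ (i, j) = monom 1 (e + a) * (adj_mat B * G) $$ (i, j)"
        using arg_cong[OF detBP, of "\<lambda>M. M $$ (i, j)"] that P adj G by (simp del: index_mult_mat(1))
      then have "monom 1 (e + a) dvd det B * P $$ (i, j)" by simp
      from monom_1_dvd_cancel[OF b this] show ?thesis by (simp only: dvd_def)
    qed
    then obtain h where h: "\<And>i j. i < k \<Longrightarrow> j < n \<Longrightarrow> P $$ (i, j) = monom 1 (e + a) * h i j" by metis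
    define H where "H = mat k n (\<lambda>(i, j). h i j)"
    have H: "H \<in> carrier_mat k n" by (simp add: H_def)
    have "P = monom 1 (e + a) \<cdot>\<^sub>m H" by (rule eq_matI) (use P h in \<open>auto simp: H_def\<close>)
    then have "monom 1 (e + a) \<cdot>\<^sub>m G = monom 1 (e + a) \<cdot>\<^sub>m (B * H)"
      using BP mult_smult_distrib[OF B H] by simp
    then have "G = B * H" using G B H by (intro smult_monom_mat_cancel[of "e + a" G _ k n]) auto
    then show thesis
      using reduced[OF B H _ _ det_monic[OF S, folded B_def]] False unit unfolding B_def by simp
  qed
qed

end

section \<open>Laurent series and encoders\<close>

lemma fls_of_poly_nth: "fls_nth (fls_of_poly f) i = (if i < 0 then 0 else coeff f (nat i))"
  by (simp add: fls_of_poly_def)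

lemma fls_of_poly_simps [simp]:
  "fls_of_poly 0 = 0" "fls_of_poly 1 = 1"
  "fls_of_poly (f + g) = fls_of_poly f + fls_of_poly g"
  "fls_of_poly (f * g) = fls_of_poly f * fls_of_poly g"
  "fls_of_poly (monom 1 m) = fls_X ^ m"
  by (simp_all add: fls_of_poly_def fps_of_poly_add fps_of_poly_mult fls_times_fps_to_fls
      fps_of_poly_monom' fps_to_fls_power)

lemma fls_of_poly_sum: "fls_of_poly (sum f A) = (\<Sum>x\<in>A. fls_of_poly (f x))"
  by (induction A rule: infinite_finite_induct) auto

lemma fls_of_poly_eq_iff [simp]: "fls_of_poly f = fls_of_poly g \<longleftrightarrow> f = g"
  by (simp add: fls_of_poly_def fps_of_poly_eq_iff)

lemma fls_of_poly_eq_0_iff [simp]: "fls_of_poly f = 0 \<longleftrightarrow> f = 0"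
  using fls_of_poly_eq_iff[of f 0] by simp

lemma fls_X_power_mult_eq_iff:
  fixes f g :: "'a::comm_ring_1 fls"
  shows "fls_X ^ m * f = fls_X ^ m * g \<longleftrightarrow> f = g"
  by (simp add: fls_X_power_times_conv_shift fls_shift_eq_iff)

lemma fls_of_poly_unit:
  assumes "coeff f 0 * b = 1"
  obtains \<psi> where "fls_of_poly f * fps_to_fls \<psi> = 1"
proof -
  have "fps_of_poly f * fps_right_inverse (fps_of_poly f) b = 1"
    by (rule fps_right_inverse) (simp add: assms)
  then show thesis
    by (intro that[of "fps_right_inverse (fps_of_poly f) b"])
      (simp add: fls_of_poly_def flip: fls_times_fps_to_fls)
qed

text \<open>Finite weight characterizes the Laurent polynomials, whose finitely many negative
  exponents are cleared by one power of \<open>D\<close>.\<close>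

lemma fls_weight_finite_iff:
  fixes f :: "'a::comm_ring_1 fls"
  shows "fls_weight f < \<infinity> \<longleftrightarrow> (\<exists>m h. fls_X ^ m * f = fls_of_poly h)"
proof
  assume "fls_weight f < \<infinity>"
  then have fin: "finite {i. fls_nth f i \<noteq> 0}" by (auto simp: fls_weight_def split: if_splits)
  define m where "m = nat (- fls_subdegree f)"
  define h where "h = (\<Sum>i\<in>{i. fls_nth f i \<noteq> 0}. monom (fls_nth f i) (nat (i + int m)))"
  have ge: "i + int m \<ge> 0" if "fls_nth f i \<noteq> 0" for i
    using fls_subdegree_leI[OF that] unfolding m_def by linarith
  have "fls_nth (fls_X ^ m * f) j = fls_nth (fls_of_poly h) j" for j
  proof -
    have "coeff h (nat j) = fls_nth f (j - int m)" if "j \<ge> 0"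
    proof -
      have "coeff h (nat j) = (\<Sum>i\<in>{i. fls_nth f i \<noteq> 0}. if i = j - int m then fls_nth f i else 0)"
        unfolding h_def coeff_sum by (rule sum.cong) (use ge that in \<open>auto simp: nat_eq_iff\<close>)
      then show ?thesis using fin by (simp add: sum.delta)
    qed
    moreover have "fls_nth f (j - int m) = 0" if "j < 0" using ge[of "j - int m"] that by auto
    ultimately show ?thesis by (simp add: fls_of_poly_nth fls_X_power_times_conv_shift)
  qed
  then show "\<exists>m h. fls_X ^ m * f = fls_of_poly h" by (metis fls_eqI)
next
  assume "\<exists>m h. fls_X ^ m * f = fls_of_poly h"
  then obtain m h where eq: "fls_X ^ m * f = fls_of_poly h" by blast
  have nth: "fls_nth f i = fls_nth (fls_of_poly h) (i + int m)" for i
    unfolding eq[symmetric] by (simp add: fls_X_power_times_conv_shift)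
  have "{i. fls_nth f i \<noteq> 0} \<subseteq> {- int m..int (degree h) - int m}"
    by (auto simp: nth fls_of_poly_nth split: if_splits dest: le_degree)
  then have "finite {i. fls_nth f i \<noteq> 0}" by (rule finite_subset) auto
  then show "fls_weight f < \<infinity>" by (simp add: fls_weight_def)
qed

lemma hamming_weight_finite_iff:
  "hamming_weight u < \<infinity> \<longleftrightarrow> (\<forall>i<dim_vec u. fls_weight (vec_index u i) < \<infinity>)"
proof -
  have "(\<Sum>i\<in>A. f i) < \<infinity> \<longleftrightarrow> (\<forall>i\<in>A. f i < (\<infinity>::enat))" if "finite A" for A and f :: "nat \<Rightarrow> enat"
    using that by (induction A rule: finite_induct) (auto simp: plus_eq_infty_iff_enat)
  from this[OF finite_lessThan] show ?thesis unfolding hamming_weight_def by auto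
qed

lemma hamming_weight_finiteI:
  assumes "u \<in> carrier_vec k" "\<And>i. i < k \<Longrightarrow> fls_weight (vec_index u i) < \<infinity>"
  shows "hamming_weight u < \<infinity>"
  unfolding hamming_weight_finite_iff carrier_vecD[OF assms(1)] using assms(2) by blast

lemma hamming_weight_finiteD:
  assumes "hamming_weight u < \<infinity>" "u \<in> carrier_vec k" "i < k"
  shows "fls_weight (vec_index u i) < \<infinity>"
  using assms(1,3) unfolding hamming_weight_finite_iff carrier_vecD[OF assms(2)] by blast

lemma fls_weight_finite_mult_poly:
  fixes f :: "'a::comm_ring_1 fls"
  assumes "fls_weight f < \<infinity>"
  shows "fls_weight (fls_of_poly p * f) < \<infinity>"
proof -
  obtain m h where "fls_X ^ m * f = fls_of_poly h" using assms fls_weight_finite_iff by blast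
  then have "fls_X ^ m * (fls_of_poly p * f) = fls_of_poly (p * h)"
    by (metis fls_of_poly_simps(4) mult.left_commute)
  then show ?thesis using fls_weight_finite_iff by blast
qed

lemma fls_weight_finite_add:
  fixes f g :: "'a::comm_ring_1 fls"
  assumes "fls_weight f < \<infinity>" "fls_weight g < \<infinity>"
  shows "fls_weight (f + g) < \<infinity>"
proof -
  have "finite {i. fls_nth f i \<noteq> 0}" "finite {i. fls_nth g i \<noteq> 0}"
    using assms by (auto simp: fls_weight_def split: if_splits)
  moreover have "{i. fls_nth (f + g) i \<noteq> 0} \<subseteq> {i. fls_nth f i \<noteq> 0} \<union> {i. fls_nth g i \<noteq> 0}" by auto
  ultimately have "finite {i. fls_nth (f + g) i \<noteq> 0}" by (meson finite_UnI finite_subset)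
  then show ?thesis by (simp add: fls_weight_def)
qed

lemma fls_weight_finite_0: "fls_weight 0 < \<infinity>"
  by (simp add: fls_weight_def)

lemma fls_weight_finite_sum:
  fixes f :: "'b \<Rightarrow> 'a::comm_ring_1 fls"
  assumes "\<And>i. i \<in> A \<Longrightarrow> fls_weight (f i) < \<infinity>"
  shows "fls_weight (sum f A) < \<infinity>"
  using assms
proof (induction A rule: infinite_finite_induct)
  case (insert x A)
  have "fls_weight (f x) < \<infinity>" by (rule insert.prems) simp
  moreover have "fls_weight (sum f A) < \<infinity>" by (rule insert.IH, rule insert.prems) simp
  ultimately have "fls_weight (f x + sum f A) < \<infinity>" by (rule fls_weight_finite_add)
  then show ?case unfolding sum.insert[OF insert.hyps] .
next
  case empty
  show ?case unfolding sum.empty by (rule fls_weight_finite_0)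
next
  case (infinite A)
  show ?case unfolding sum.infinite[OF infinite.hyps] by (rule fls_weight_finite_0)
qed

section \<open>The encoding map and its effect on weights\<close>

lemma dim_encode [simp]: "dim_vec (encode G u) = dim_col G"
  by (simp add: encode_def)

lemma encode_carrier: "G \<in> carrier_mat k n \<Longrightarrow> encode G u \<in> carrier_vec n"
  by (rule carrier_vecI) simp

lemma encode_index:
  assumes "G \<in> carrier_mat k n" "u \<in> carrier_vec k" "l < n"
  shows "vec_index (encode G u) l = (\<Sum>i<k. fls_of_poly (G $$ (i, l)) * vec_index u i)"
  using assms by (auto simp: encode_def scalar_prod_def atLeast0LessThan intro!: sum.cong)

lemma encode_mult:
  assumes A: "A \<in> carrier_mat j k" and B: "B \<in> carrier_mat k n" and u: "u \<in> carrier_vec j"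
  shows "encode (A * B) u = encode B (encode A u)"
proof (rule eq_vecI)
  have AB: "A * B \<in> carrier_mat j n" using A B by simp
  show "dim_vec (encode (A * B) u) = dim_vec (encode B (encode A u))"
    using encode_carrier[OF AB, of u] encode_carrier[OF B] by (metis carrier_vecD)
  fix l assume "l < dim_vec (encode B (encode A u))"
  then have l: "l < n" using encode_carrier[OF B] by (metis carrier_vecD)
  have "vec_index (encode (A * B) u) l =
      (\<Sum>i<j. \<Sum>t<k. fls_of_poly (B $$ (t, l)) * (fls_of_poly (A $$ (i, t)) * vec_index u i))"
    unfolding encode_index[OF AB u l]
    by (rule sum.cong)
      (use mult_mat_index[OF A B _ l] in \<open>auto simp: fls_of_poly_sum sum_distrib_left
        sum_distrib_right ac_simps simp del: index_mult_mat\<close>)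
  also have "\<dots> = (\<Sum>t<k. fls_of_poly (B $$ (t, l)) * (\<Sum>i<j. fls_of_poly (A $$ (i, t)) * vec_index u i))"
    by (subst sum.swap) (simp add: sum_distrib_left)
  also have "\<dots> = vec_index (encode B (encode A u)) l"
    unfolding encode_index[OF B encode_carrier[OF A] l]
    by (rule sum.cong) (auto simp: encode_index[OF A u])
  finally show "vec_index (encode (A * B) u) l = vec_index (encode B (encode A u)) l" .
qed

lemma encode_smult:
  assumes "G \<in> carrier_mat k n" "u \<in> carrier_vec k"
  shows "encode G (c \<cdot>\<^sub>v u) = c \<cdot>\<^sub>v encode G u"
proof (rule eq_vecI)
  fix l assume "l < dim_vec (c \<cdot>\<^sub>v encode G u)"
  then have l: "l < n" using assms by simp
  have cu: "c \<cdot>\<^sub>v u \<in> carrier_vec k" using assms by simp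
  show "vec_index (encode G (c \<cdot>\<^sub>v u)) l = vec_index (c \<cdot>\<^sub>v encode G u) l"
    using encode_index[OF assms(1) cu l] encode_index[OF assms l] l assms
    by (simp add: sum_distrib_left ac_simps)
qed simp

lemma encode_zero:
  assumes "G \<in> carrier_mat k n"
  shows "encode G (0\<^sub>v k) = 0\<^sub>v n"
proof (rule eq_vecI)
  fix l assume "l < dim_vec (0\<^sub>v n :: 'a fls vec)"
  then have l: "l < n" by simp
  show "vec_index (encode G (0\<^sub>v k)) l = vec_index (0\<^sub>v n) l"
    using l by (simp add: encode_index[OF assms zero_carrier_vec l])
qed (use assms in simp)

lemma encode_smult_mat:
  assumes "G \<in> carrier_mat k n" "u \<in> carrier_vec k"
  shows "encode (c \<cdot>\<^sub>m G) u = fls_of_poly c \<cdot>\<^sub>v encode G u"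
proof -
  have cG: "c \<cdot>\<^sub>m G \<in> carrier_mat k n" using assms by simp
  show ?thesis
  proof (rule eq_vecI)
    fix l assume "l < dim_vec (fls_of_poly c \<cdot>\<^sub>v encode G u)"
    then have l: "l < n" using assms(1) by simp
    show "vec_index (encode (c \<cdot>\<^sub>m G) u) l = vec_index (fls_of_poly c \<cdot>\<^sub>v encode G u) l"
      using encode_index[OF cG assms(2) l] encode_index[OF assms l] l assms(1)
      by (simp add: sum_distrib_left ac_simps)
  qed (use assms(1) in simp)
qed

lemma encode_one:
  assumes "u \<in> carrier_vec k"
  shows "encode (1\<^sub>m k) u = u"
proof (rule eq_vecI)
  fix l assume "l < dim_vec u"
  then have l: "l < k" using assms by simp
  have "vec_index (encode (1\<^sub>m k) u) l = (\<Sum>i<k. if i = l then vec_index u i else 0)"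
    unfolding encode_index[OF one_carrier_mat assms l] by (rule sum.cong) (use l in auto)
  then show "vec_index (encode (1\<^sub>m k) u) l = vec_index u l" using l by simp
qed (use assms in auto)

lemma encode_scalar_mat:
  assumes "u \<in> carrier_vec k"
  shows "encode (c \<cdot>\<^sub>m 1\<^sub>m k) u = fls_of_poly c \<cdot>\<^sub>v u"
  using encode_smult_mat[OF one_carrier_mat assms] encode_one[OF assms] by simp

lemma encode_eq_imp_eq:
  assumes A: "A \<in> carrier_mat k n" and B: "B \<in> carrier_mat k n"
    and eq: "\<And>u. u \<in> carrier_vec k \<Longrightarrow> encode A u = encode B u"
  shows "A = B"
proof (rule eq_matI)
  fix i l assume "i < dim_row B" "l < dim_col B"
  then have il: "i < k" "l < n" using B by auto
  have unit: "vec_index (encode M (unit_vec k i)) l = fls_of_poly (M $$ (i, l))"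
    if M: "M \<in> carrier_mat k n" for M :: "'a poly mat"
  proof -
    have "vec_index (encode M (unit_vec k i)) l = (\<Sum>t<k. if t = i then fls_of_poly (M $$ (t, l)) else 0)"
      unfolding encode_index[OF M unit_vec_carrier il(2)] by (rule sum.cong) (use il in auto)
    then show ?thesis using il by simp
  qed
  have "fls_of_poly (A $$ (i, l)) = fls_of_poly (B $$ (i, l))"
    using eq[OF unit_vec_carrier, of i] unit[OF A] unit[OF B] by simp
  then show "A $$ (i, l) = B $$ (i, l)" by simp
qed (use A B in auto)

lemma hamming_weight_encode_finite:
  assumes G: "G \<in> carrier_mat k n" and u: "u \<in> carrier_vec k" "hamming_weight u < \<infinity>"
  shows "hamming_weight (encode G u) < \<infinity>"
proof (rule hamming_weight_finiteI[OF encode_carrier[OF G]])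
  fix l assume l: "l < n"
  have "fls_weight (vec_index u i) < \<infinity>" if "i < k" for i
    by (rule hamming_weight_finiteD[OF u(2,1) that])
  then show "fls_weight (vec_index (encode G u) l) < \<infinity>"
    unfolding encode_index[OF G u(1) l]
    by (intro fls_weight_finite_sum fls_weight_finite_mult_poly) auto
qed

text \<open>\<open>Q\<close> decodes: being polynomial, it sends an output of finite weight to
  \<open>D ^ m u\<close> of finite weight, and shifts preserve finiteness.\<close>

lemma noncatastrophic_of_right_factor:
  fixes G :: "'a::comm_ring_1 poly mat"
  assumes G: "G \<in> carrier_mat k n" and Q: "Q \<in> carrier_mat n k" and GQ: "G * Q = monom 1 m \<cdot>\<^sub>m 1\<^sub>m k"
  shows "noncatastrophic_matrix G"
  unfolding noncatastrophic_matrix_def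
proof (intro ballI iffI)
  fix u :: "'a fls vec" assume "u \<in> carrier_vec (dim_row G)"
  then have u: "u \<in> carrier_vec k" using G by simp
  show "hamming_weight (encode G u) < \<infinity>" if "hamming_weight u < \<infinity>"
    by (rule hamming_weight_encode_finite[OF G u that])
  assume "hamming_weight (encode G u) < \<infinity>"
  from hamming_weight_encode_finite[OF Q encode_carrier[OF G] this]
  have fin: "hamming_weight (fls_X ^ m \<cdot>\<^sub>v u) < \<infinity>"
    unfolding encode_mult[OF G Q u, symmetric] GQ encode_scalar_mat[OF u] by simp
  have *: "fls_weight (fls_X ^ m * vec_index u i) < \<infinity>" if "i < k" for i
  proof -
    have Xu: "fls_X ^ m \<cdot>\<^sub>v u \<in> carrier_vec k" using u by simp
    have "vec_index (fls_X ^ m \<cdot>\<^sub>v u) i = fls_X ^ m * vec_index u i" using u that by simp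
    with hamming_weight_finiteD[OF fin Xu that] show ?thesis by (simp only:)
  qed
  have "fls_weight (vec_index u i) < \<infinity>" if i: "i < k" for i
  proof -
    obtain m' h where "fls_X ^ m' * (fls_X ^ m * vec_index u i) = fls_of_poly h"
      using *[OF i] fls_weight_finite_iff by blast
    then have "fls_X ^ (m' + m) * vec_index u i = fls_of_poly h" by (simp add: power_add mult.assoc)
    then show ?thesis using fls_weight_finite_iff by blast
  qed
  then show "hamming_weight u < \<infinity>" by (rule hamming_weight_finiteI[OF u])
qed

section \<open>Change of encoder and internal degree\<close>

lemma full_rankD:
  assumes "full_rank G" "G \<in> carrier_mat k n" "u \<in> carrier_vec k" "encode G u = 0\<^sub>v n"
  shows "u = 0\<^sub>v k"
  using assms unfolding full_rank_def by auto

lemma code_of_iff: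
  assumes "G \<in> carrier_mat k n"
  shows "x \<in> code_of G \<longleftrightarrow> (\<exists>u\<in>carrier_vec k. x = encode G u)"
  using assms by (auto simp: code_of_def)

text \<open>The unit constant term makes \<open>B\<close> invertible over the Laurent series, so
  that it permutes the inputs and leaves the set of outputs unchanged.\<close>

lemma generator_matrix_cancel:
  assumes BH: "generator_matrix k n C (B * H)"
    and B: "B \<in> carrier_mat k k" and H: "H \<in> carrier_mat k n" and unit: "coeff (det B) 0 * b = 1"
  shows "generator_matrix k n C H"
proof -
  obtain \<psi> where \<psi>: "fls_of_poly (det B) * fps_to_fls \<psi> = 1" using fls_of_poly_unit[OF unit] .
  note adj = adj_mat[OF B]
  \<comment> \<open>\<open>w u\<close> is \<open>u\<close> times the inverse of \<open>B\<close>,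
    written as adjugate over determinant.\<close>
  define w where "w u = fps_to_fls \<psi> \<cdot>\<^sub>v encode (adj_mat B) u" for u
  have w: "w u \<in> carrier_vec k" for u using encode_carrier[OF adj(1)] by (simp add: w_def)
  have Binv: "encode B (w u) = u" if "u \<in> carrier_vec k" for u
  proof -
    have "encode B (w u) = fps_to_fls \<psi> \<cdot>\<^sub>v encode (adj_mat B * B) u"
      unfolding w_def encode_mult[OF adj(1) B that] by (rule encode_smult[OF B encode_carrier[OF adj(1)]])
    also have "\<dots> = u"
      unfolding adj(3) encode_scalar_mat[OF that]
      using \<psi> by (intro eq_vecI) (auto simp: mult.commute simp flip: mult.assoc)
    finally show ?thesis .
  qed
  have BH': "B * H \<in> carrier_mat k n" "full_rank (B * H)" "code_of (B * H) = C"
    using BH by (auto simp: generator_matrix_def)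
  have eq: "encode H u = encode (B * H) (w u)" if "u \<in> carrier_vec k" for u
    unfolding encode_mult[OF B H w] Binv[OF that] ..
  have "full_rank H"
    unfolding full_rank_def
  proof (intro ballI impI)
    fix u assume "u \<in> carrier_vec (dim_row H)" "encode H u = 0\<^sub>v (dim_col H)"
    then have u: "u \<in> carrier_vec k" "encode H u = 0\<^sub>v n" using H by auto
    from full_rankD[OF BH'(2,1) w] eq[OF u(1)] u(2) have "w u = 0\<^sub>v k" by simp
    then have "u = encode B (0\<^sub>v k)" using Binv[OF u(1)] by simp
    also have "\<dots> = 0\<^sub>v k" by (rule encode_zero[OF B])
    finally show "u = 0\<^sub>v (dim_row H)" using H by simp
  qed
  moreover have "code_of H = code_of (B * H)"
  proof (intro Set.set_eqI iffI)
    fix x assume "x \<in> code_of H"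
    then obtain u where "u \<in> carrier_vec k" "x = encode H u" unfolding code_of_iff[OF H] by blast
    then show "x \<in> code_of (B * H)" unfolding code_of_iff[OF BH'(1)] using eq w by blast
  next
    fix x assume "x \<in> code_of (B * H)"
    then obtain u where u: "u \<in> carrier_vec k" "x = encode (B * H) u"
      unfolding code_of_iff[OF BH'(1)] by blast
    then show "x \<in> code_of H"
      unfolding code_of_iff[OF H] u(2) encode_mult[OF B H u(1)] using encode_carrier[OF B] by blast
  qed
  ultimately show ?thesis using H BH' by (simp add: generator_matrix_def)
qed

text \<open>As \<open>det B\<close> is monic of degree \<open>N\<close>, every nonzero minor gains
  exactly \<open>N\<close> in degree, even with zero divisors.\<close>

lemma internal_degree_less:
  assumes B: "B \<in> carrier_mat k k" and H: "H \<in> carrier_mat k n"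
    and N: "N > 0" "degree (det B) \<le> N" "coeff (det B) N = 1" and nz: "\<not> full_minors H \<subseteq> {0}"
  shows "internal_degree H < internal_degree (B * H)"
proof -
  let ?M = "full_minors H"
  have fin: "finite (degree ` ?M)" "finite (degree ` full_minors (B * H))"
    by (simp_all add: finite_full_minors)
  have ge: "N + degree x \<le> internal_degree (B * H)" if "x \<in> ?M" "x \<noteq> 0" for x
    using degree_mult_monic[OF N(2,3) that(2)] that(1) fin(2) unfolding internal_degree_def
    by (metis full_minors_mult_left[OF B H] Max_ge imageI)
  have "degree ` ?M \<noteq> {}" using nz by auto
  from Max_in[OF fin(1) this] obtain x where x: "x \<in> ?M" "internal_degree H = degree x"
    unfolding internal_degree_def by blast
  show ?thesis
  proof (cases "x = 0")
    case False
    then show ?thesis using ge[OF x(1)] x(2) N by simp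
  next
    \<comment> \<open>The maximum may be attained at a zero minor, of degree 0 by convention; then
      any nonzero minor gives the bound.\<close>
    case True
    obtain y where "y \<in> ?M" "y \<noteq> 0" using nz by blast
    then show ?thesis using ge[of y] x(2) True N by simp
  qed
qed

section \<open>Noncatastrophic encoders\<close>

context nilpotent_reduction
begin

text \<open>A relation \<open>v\<close> between the reduced rows lifts to the relation
  \<open>\<pi> ^ (r - 1)\<close> times a lift of \<open>v\<close> between the rows of
  \<open>G\<close>, and this multiple vanishes only if \<open>v\<close> does.\<close>

lemma full_rank_reduction:
  assumes G: "G \<in> carrier_mat k n" and rank: "full_rank G"
    and v: "\<And>l. l < n \<Longrightarrow> (\<Sum>i<k. v i * redm G $$ (i, l)) = 0" and i: "i < k"
  shows "v i = 0"
proof -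
  define u where "u = vec k (\<lambda>i. fls_of_poly (smult (\<pi> ^ (r - 1)) (lift_poly (v i))))"
  have u: "u \<in> carrier_vec k" by (simp add: u_def)
  have "encode G u = 0\<^sub>v n"
  proof (rule eq_vecI)
    fix l assume "l < dim_vec (0\<^sub>v n :: 'a fls vec)"
    then have l: "l < n" by simp
    let ?x = "\<Sum>i<k. lift_poly (v i) * G $$ (i, l)"
    have "map_poly red ?x = (\<Sum>i<k. v i * redm G $$ (i, l))"
      unfolding redp.hom_sum by (rule sum.cong) (use G l in \<open>auto simp: redp.hom_mult\<close>)
    then have x: "smult (\<pi> ^ (r - 1)) ?x = 0" using v[OF l] redp_annihilator by metis
    have "vec_index (encode G u) l = fls_of_poly (smult (\<pi> ^ (r - 1)) ?x)"
      unfolding encode_index[OF G u l] smult_sum2 fls_of_poly_sum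
      by (rule sum.cong) (auto simp: u_def mult.commute simp flip: fls_of_poly_simps(4))
    then show "vec_index (encode G u) l = vec_index (0\<^sub>v n) l" unfolding x using l by simp
  qed (use G in simp)
  from full_rankD[OF rank G u this] have "vec_index u i = 0" using i by simp
  then have "map_poly red (lift_poly (v i)) = 0" using i redp_annihilator by (simp add: u_def)
  then show ?thesis by simp
qed

text \<open>McCoy's theorem for the zero ideal: if all reduced minors vanished, the reduced rows
  would be dependent.\<close>

lemma full_minors_reduction_nonzero:
  assumes G: "G \<in> carrier_mat k n" and rank: "full_rank G"
  shows "\<not> full_minors (redm G) \<subseteq> {0}"
proof
  assume sub: "full_minors (redm G) \<subseteq> {0}"
  have I: "is_ideal {0 :: 'b poly}" "1 \<notin> {0 :: 'b poly}" by (simp_all add: is_ideal_def)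
  have rG: "redm G \<in> carrier_mat k n" using G by simp
  obtain v i where "i < k" "v i \<notin> {0}"
    "\<And>l. l < n \<Longrightarrow> (\<Sum>i<k. v i * redm G $$ (i, l)) \<in> {0}"
    by (rule full_minors_ideal[OF I rG sub]) (rule that)
  then show False using full_rank_reduction[OF G rank, of v i] by simp
qed

text \<open>If the greatest common divisor of the minors modulo \<open>\<pi>\<close> has a nonconstant factor \<open>g\<close> prime
  to \<open>D\<close>, then some \<open>v\<close> not divisible by \<open>g\<close> satisfies \<open>g | v G\<close>, and \<open>\<pi> ^ (r - 1) v / g\<close> is an
  input of infinite weight with output of finite weight.\<close>

lemma Gcd_minors_of_noncatastrophic:
  assumes G: "G \<in> carrier_mat k n" and rank: "full_rank G" and noncat: "noncatastrophic_matrix G"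
  shows "\<exists>s. Gcd (full_minors (redm G)) = monom 1 s"
proof -
  define \<Delta> where "\<Delta> = Gcd (full_minors (redm G))"
  have "\<Delta> \<noteq> 0" using full_minors_reduction_nonzero[OF G rank] by (simp add: \<Delta>_def)
  then obtain a g where g: "\<Delta> = monom 1 a * g" "coeff g 0 \<noteq> 0" using poly_split_monom by blast
  have unit: "is_unit g"
  proof (rule ccontr)
    assume nu: "\<not> is_unit g"
    \<comment> \<open>The preimage of the ideal of \<open>g\<close>, so that the witness
      \<open>v\<close> lives over the original ring.\<close>
    define I where "I = {x. g dvd map_poly red x}"
    have I: "is_ideal I" by (auto simp: is_ideal_def I_def redp.hom_add redp.hom_mult)
    have "1 \<notin> I" using nu by (simp add: I_def)
    moreover have "full_minors G \<subseteq> I"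
    proof
      fix x assume "x \<in> full_minors G"
      then have "map_poly red x \<in> full_minors (redm G)" unfolding full_minors_hom[OF G] by blast
      then have "\<Delta> dvd map_poly red x" unfolding \<Delta>_def by (rule Gcd_dvd)
      then show "x \<in> I" unfolding I_def g(1) by (auto dest: dvd_mult_right)
    qed
    ultimately obtain v i where i: "i < k" "v i \<notin> I"
      and v: "\<And>l. l < n \<Longrightarrow> (\<Sum>i<k. v i * G $$ (i, l)) \<in> I"
      using full_minors_ideal[OF I _ G] by metis
    \<comment> \<open>The lift of \<open>g\<close> has a unit constant term, and its power series
      inverse \<open>\<psi>\<close> stands for \<open>1 / g\<close>.\<close>
    define F where "F = lift_poly g"
    have "red (coeff F 0) = coeff g 0" unfolding F_def by (metis coeff_map_poly_hom redp_lift_poly)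
    then have "red (coeff F 0) \<noteq> 0" using g(2) by simp
    then obtain b where "coeff F 0 * b = 1" by (rule unit_of_red_nonzero)
    then obtain \<psi> where \<psi>: "fls_of_poly F * fps_to_fls \<psi> = 1" by (rule fls_of_poly_unit)
    let ?c = "\<pi> ^ (r - 1)"
    define u where "u = vec k (\<lambda>i. fls_of_poly (smult ?c (v i)) * fps_to_fls \<psi>)"
    have u: "u \<in> carrier_vec k" by (simp add: u_def)
    have "hamming_weight (encode G u) < \<infinity>"
    proof (rule hamming_weight_finiteI[OF encode_carrier[OF G]])
      fix l assume l: "l < n"
      let ?x = "\<Sum>i<k. v i * G $$ (i, l)"
      have "g dvd map_poly red ?x" using v[OF l] by (simp only: I_def mem_Collect_eq)
      then obtain q where q: "map_poly red ?x = g * q" by (rule dvdE)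
      have "map_poly red (?x - F * lift_poly q) = 0"
        unfolding redp.hom_minus redp.hom_mult q F_def by simp
      then have "smult ?c (?x - F * lift_poly q) = 0" using redp_annihilator by blast
      then have x: "smult ?c ?x = F * smult ?c (lift_poly q)" by (simp add: smult_diff_right)
      have "vec_index (encode G u) l = fls_of_poly (smult ?c ?x) * fps_to_fls \<psi>"
        unfolding encode_index[OF G u l] smult_sum2 fls_of_poly_sum sum_distrib_right
      proof (rule sum.cong)
        fix i assume "i \<in> {..<k}"
        moreover have "smult ?c (v i * G $$ (i, l)) = G $$ (i, l) * smult ?c (v i)"
          by (simp add: mult.commute)
        ultimately show "fls_of_poly (G $$ (i, l)) * vec_index u i =
            fls_of_poly (smult ?c (v i * G $$ (i, l))) * fps_to_fls \<psi>"
          by (simp only: u_def index_vec lessThan_iff fls_of_poly_simps(4) mult.assoc)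
      qed simp
      also have "\<dots> = fls_of_poly (smult ?c (lift_poly q)) * (fls_of_poly F * fps_to_fls \<psi>)"
        unfolding x fls_of_poly_simps(4) by (simp only: ac_simps)
      finally have "fls_X ^ 0 * vec_index (encode G u) l = fls_of_poly (smult ?c (lift_poly q))"
        unfolding \<psi> by simp
      then show "fls_weight (vec_index (encode G u) l) < \<infinity>" using fls_weight_finite_iff by blast
    qed
    then have "hamming_weight u < \<infinity>"
      using noncat u G unfolding noncatastrophic_matrix_def by auto
    from hamming_weight_finiteD[OF this u i(1)]
    obtain m h where h: "fls_X ^ m * vec_index u i = fls_of_poly h" using fls_weight_finite_iff by blast
    let ?w = "monom 1 m * v i"
    have ui: "fls_X ^ m * vec_index u i = fls_of_poly (smult ?c ?w) * fps_to_fls \<psi>"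
    proof -
      have "fls_X ^ m * fls_of_poly (smult ?c (v i)) = fls_of_poly (smult ?c ?w)"
        by (simp flip: fls_of_poly_simps(4,5))
      then show ?thesis using i(1) by (simp add: u_def flip: mult.assoc)
    qed
    \<comment> \<open>All coefficients of \<open>h\<close> are divisible by
      \<open>\<pi> ^ (r - 1)\<close>. Cancelling this factor modulo \<open>\<pi>\<close> shows that
      \<open>g\<close> divides \<open>D ^ m\<close> times the reduction of \<open>v i\<close>, and
      \<open>g\<close> is prime to \<open>D\<close>.\<close>
    have "fps_to_fls (fps_of_poly h) = fps_to_fls (fps_of_poly (smult ?c ?w) * \<psi>)"
      using h ui by (simp add: fls_of_poly_def fls_times_fps_to_fls)
    then have "fps_of_poly h = fps_of_poly (smult ?c ?w) * \<psi>" by (simp only: fps_to_fls_eq_iff)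
    also have "\<dots> = fps_const ?c * (fps_of_poly ?w * \<psi>)"
      by (simp only: fps_of_poly_smult mult.assoc)
    finally have "fps_nth (fps_of_poly h) t = ?c * fps_nth (fps_of_poly ?w * \<psi>) t" for t by simp
    then have "[:?c:] dvd h" by (simp add: const_dvd_poly_iff)
    then obtain h' where h': "h = smult ?c h'" by (auto elim: dvdE)
    have "fls_of_poly (F * h) = fls_of_poly (smult ?c ?w) * (fls_of_poly F * fps_to_fls \<psi>)"
      unfolding fls_of_poly_simps(4) h[symmetric] ui by (simp only: ac_simps)
    then have "F * h = smult ?c ?w" unfolding \<psi> mult_1_right fls_of_poly_eq_iff .
    then have "smult ?c (?w - F * h') = 0" by (simp add: h' smult_diff_right)
    then have "map_poly red (?w - F * h') = 0" using redp_annihilator by blast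
    then have eq: "monom 1 m * map_poly red (v i) = g * map_poly red h'"
      unfolding redp.hom_minus redp.hom_mult by (simp add: F_def map_poly_monom)
    obtain \<alpha> \<beta> where ab: "monom 1 m * \<alpha> + g * \<beta> = 1" using monom_unit_mod[OF g(2)] .
    have "g dvd \<alpha> * (monom 1 m * map_poly red (v i)) + g * (\<beta> * map_poly red (v i))"
      unfolding eq by (simp add: dvd_mult)
    also have "\<dots> = (monom 1 m * \<alpha> + g * \<beta>) * map_poly red (v i)"
      by (simp add: algebra_simps)
    finally have "v i \<in> I" unfolding ab I_def by simp
    then show False using i by simp
  qed
  have "\<Delta> = normalize \<Delta>" by (simp add: \<Delta>_def)
  also have "\<dots> = monom 1 a" unfolding g(1) normalize_mult_unit_right[OF unit] by simp
  finally show ?thesis unfolding \<Delta>_def by blast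
qed

text \<open>\<open>G * Q\<close> is \<open>D ^ m\<close> times the change of inputs:
  \<open>u G = w G'\<close> implies \<open>u G Q = D ^ m w\<close>. If this vanishes, so do
  \<open>w\<close>, \<open>u G\<close> and \<open>u\<close>; thus \<open>G * Q\<close> has full
  rank, which survives reduction.\<close>

lemma generator_matrices_factor:
  fixes G G' :: "'a poly mat"
  assumes G: "generator_matrix k n C G" and G': "generator_matrix k n C G'"
    and Q: "Q \<in> carrier_mat n k" and GQ: "G' * Q = monom 1 m \<cdot>\<^sub>m 1\<^sub>m k"
  shows "monom 1 m \<cdot>\<^sub>m G = (G * Q) * G'" and "det (redm (G * Q)) \<noteq> 0"
proof -
  have cG: "G \<in> carrier_mat k n" "full_rank G" "code_of G = C" using G by (auto simp: generator_matrix_def)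
  have cG': "G' \<in> carrier_mat k n" "full_rank G'" "code_of G' = C" using G' by (auto simp: generator_matrix_def)
  have U: "G * Q \<in> carrier_mat k k" using cG Q by simp
  have ex: "\<exists>w\<in>carrier_vec k. encode G u = encode G' w" if "u \<in> carrier_vec k" for u
  proof -
    have "encode G u \<in> code_of G'" using that cG(3) cG'(3) code_of_iff[OF cG(1)] by blast
    then show ?thesis unfolding code_of_iff[OF cG'(1)] .
  qed
  have shift: "encode (G * Q) u = fls_X ^ m \<cdot>\<^sub>v w"
    if "u \<in> carrier_vec k" "w \<in> carrier_vec k" "encode G u = encode G' w" for u w
    unfolding encode_mult[OF cG(1) Q that(1)] that(3) encode_mult[OF cG'(1) Q that(2), symmetric] GQ
      encode_scalar_mat[OF that(2)] by simp
  show "monom 1 m \<cdot>\<^sub>m G = (G * Q) * G'"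
  proof (rule encode_eq_imp_eq)
    fix u :: "'a fls vec" assume u: "u \<in> carrier_vec k"
    obtain w where w: "w \<in> carrier_vec k" "encode G u = encode G' w" using ex[OF u] by blast
    have "encode (monom 1 m \<cdot>\<^sub>m G) u = fls_X ^ m \<cdot>\<^sub>v encode G' w"
      unfolding encode_smult_mat[OF cG(1) u] w(2) by simp
    also have "\<dots> = encode (G * Q * G') u"
      unfolding encode_mult[OF U cG'(1) u] shift[OF u w] encode_smult[OF cG'(1) w(1)] ..
    finally show "encode (monom 1 m \<cdot>\<^sub>m G) u = encode (G * Q * G') u" .
  qed (rule smult_carrier_mat[OF cG(1)], rule mult_carrier_mat[OF U cG'(1)])
  have "full_rank (G * Q)"
    unfolding full_rank_def
  proof (intro ballI impI)
    fix u assume "u \<in> carrier_vec (dim_row (G * Q))" "encode (G * Q) u = 0\<^sub>v (dim_col (G * Q))"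
    then have u: "u \<in> carrier_vec k" "encode (G * Q) u = 0\<^sub>v k" using U by auto
    obtain w where w: "w \<in> carrier_vec k" "encode G u = encode G' w" using ex[OF u(1)] by blast
    have "w = 0\<^sub>v k"
    proof (rule eq_vecI)
      fix i assume "i < dim_vec (0\<^sub>v k :: 'a fls vec)"
      then have "fls_X ^ m * vec_index w i = fls_X ^ m * 0"
        using arg_cong[OF shift[OF u(1) w, unfolded u(2)], of "\<lambda>x. vec_index x i"] w(1) by simp
      then show "vec_index w i = vec_index (0\<^sub>v k) i"
        using \<open>i < _\<close> unfolding fls_X_power_mult_eq_iff by simp
    qed (use w in simp)
    then have "encode G u = 0\<^sub>v n" using w(2) encode_zero[OF cG'(1)] by simp
    from full_rankD[OF cG(2,1) u(1) this] show "u = 0\<^sub>v (dim_row (G * Q))" using cG(1) by simp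
  qed
  from full_minors_reduction_nonzero[OF U this]
  obtain x where x: "x \<in> full_minors (redm (G * Q))" "x \<noteq> 0" by blast
  have rU: "redm (G * Q) \<in> carrier_mat k k" using U by simp
  obtain J where J: "J \<subseteq> {..<k}" "card J = k" "x = det (submatrix (redm (G * Q)) UNIV J)"
    using full_minorsE[OF x(1) rU] .
  have "x = det (redm (G * Q)) * det (select_mat k k (pick J))"
    unfolding J(3) submatrix_columns(3)[OF rU J(1,2)] by (rule det_mult[OF rU select_mat_carrier(1)])
  then show "det (redm (G * Q)) \<noteq> 0" using x(2) by auto
qed

text \<open>The case \<open>reduced\<close> would give an encoder of smaller internal degree. In the
  case \<open>invertible\<close>, \<open>G * Q\<close> is invertible over the Laurent polynomials,
  and \<open>Q * Y\<close> is the right factor.\<close>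

lemma right_factor_of_reduced_internal_degree:
  fixes G G' :: "'a poly mat"
  assumes G: "reduced_internal_degree_matrix k n C G"
    and G': "generator_matrix k n C G'" "noncatastrophic_matrix G'"
  obtains Q m where "Q \<in> carrier_mat n k" "G * Q = monom 1 m \<cdot>\<^sub>m 1\<^sub>m k"
proof -
  have gG: "generator_matrix k n C G"
    and min: "\<And>H. generator_matrix k n C H \<Longrightarrow> internal_degree G \<le> internal_degree H"
    using G by (auto simp: reduced_internal_degree_matrix_def)
  have cG: "G \<in> carrier_mat k n" using gG by (simp add: generator_matrix_def)
  have cG': "G' \<in> carrier_mat k n" "full_rank G'" using G' by (simp_all add: generator_matrix_def)
  obtain s where "Gcd (full_minors (redm G')) = monom 1 s"
    using Gcd_minors_of_noncatastrophic[OF cG' G'(2)] by blast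
  then obtain Q m where Q: "Q \<in> carrier_mat n k" and GQ: "G' * Q = monom 1 m \<cdot>\<^sub>m 1\<^sub>m k"
    by (rule right_factor_of_Gcd_minors[OF cG'(1)])
  note fac = generator_matrices_factor[OF gG G'(1) Q GQ]
  have U: "G * Q \<in> carrier_mat k k" using cG Q by simp
  from cG cG'(1) U fac show thesis
  proof (cases rule: reduce_or_invertible)
    case (invertible Y m)
    then show thesis using assoc_mult_mat[OF cG Q invertible(1)] Q that[of "Q * Y" m] by simp
  next
    case (reduced B H N)
    obtain b where b: "coeff (det B) 0 * b = 1" by (rule unit_of_red_nonzero[OF reduced(7)])
    have "generator_matrix k n C H"
      by (rule generator_matrix_cancel[OF _ reduced(1,2) b]) (use gG reduced(3) in simp)
    moreover have "\<not> full_minors H \<subseteq> {0}"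
    proof
      assume "full_minors H \<subseteq> {0}"
      then have "full_minors (redm H) \<subseteq> {0}" unfolding full_minors_hom[OF reduced(2)] by auto
      then show False
        using full_minors_reduction_nonzero[OF reduced(2)] calculation by (simp add: generator_matrix_def)
    qed
    ultimately have False
      using internal_degree_less[OF reduced(1,2,4,5,6)] min[of H] reduced(3) by simp
    then show thesis ..
  qed
qed

end

section \<open>Integers modulo a prime power\<close>

lemma of_int_mod_ring_surj: "\<exists>x. a = (of_int x :: 'q::nontriv mod_ring)"
  by (metis of_int_of_int_mod_ring of_int_mod_ring_to_int_mod_ring)

lemma of_int_mod_ring_eq_0_iff: "(of_int x :: 'q::nontriv mod_ring) = 0 \<longleftrightarrow> int CARD('q) dvd x"
  by (simp add: of_int_eq_0_iff_char_dvd)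

text \<open>The integer representative used by \<open>reduce\<close> differs from \<open>x\<close>
  by a multiple of \<open>CARD('q)\<close>, which vanishes modulo \<open>CARD('p)\<close>.\<close>

lemma reduce_of_int:
  assumes "CARD('p::prime_card) dvd CARD('q::nontriv)"
  shows "(reduce (of_int x :: 'q mod_ring) :: 'p mod_ring) = of_int x"
proof -
  let ?y = "to_int_mod_ring (of_int x :: 'q mod_ring)"
  have "(of_int ?y :: 'q mod_ring) = of_int x"
    by (simp only: of_int_of_int_mod_ring of_int_mod_ring_to_int_mod_ring)
  then have "(of_int (?y - x) :: 'q mod_ring) = 0" by simp
  then have "int CARD('p) dvd ?y - x"
    unfolding of_int_mod_ring_eq_0_iff using assms by (meson dvd_trans int_dvd_int_iff)
  then have "(of_int (?y - x) :: 'p mod_ring) = 0" unfolding of_int_mod_ring_eq_0_iff .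
  then have "(of_int ?y :: 'p mod_ring) = of_int x" by simp
  then show ?thesis by (simp only: reduce_def of_int_of_int_mod_ring)
qed

text \<open>Every residue is the image of an integer, so the conditions of the locale are checked on
  integers.\<close>

lemma nilpotent_reduction_mod_ring:
  assumes "prime p" "r \<ge> 1" and p: "CARD('p::prime_card) = p" and q: "CARD('q::nontriv) = p ^ r"
  shows "nilpotent_reduction (reduce :: 'q mod_ring \<Rightarrow> 'p mod_ring) (of_nat p) r"
proof -
  have dvd: "CARD('p) dvd CARD('q)" using p q assms by (simp add: dvd_power)
  note red = reduce_of_int[OF dvd]
  have p_pos: "p > 0" using assms by (simp add: prime_gt_0_nat)
  have hom: "reduce (a + b) = (reduce a + reduce b :: 'p mod_ring)"
    "reduce (a * b) = (reduce a * reduce b :: 'p mod_ring)" for a b :: "'q mod_ring"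
  proof -
    obtain x y where "a = of_int x" "b = of_int y" using of_int_mod_ring_surj by metis
    then show "reduce (a + b) = (reduce a + reduce b :: 'p mod_ring)"
      "reduce (a * b) = (reduce a * reduce b :: 'p mod_ring)"
      using red[of x] red[of y] red[of "x + y"] red[of "x * y"] by simp_all
  qed
  have p_dvd: "of_nat p dvd (of_int x :: 'q mod_ring) \<longleftrightarrow> int p dvd x" for x
  proof
    assume "of_nat p dvd (of_int x :: 'q mod_ring)"
    then obtain b where b: "of_int x = of_nat p * (b :: 'q mod_ring)" by (rule dvdE)
    obtain y where "b = of_int y" using of_int_mod_ring_surj by blast
    then have "(of_int (x - int p * y) :: 'q mod_ring) = 0" using b by simp
    then have "int CARD('q) dvd x - int p * y" unfolding of_int_mod_ring_eq_0_iff .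
    moreover have "int p dvd int CARD('q)" unfolding q using assms(2) by (simp add: dvd_power)
    ultimately have "int p dvd x - int p * y" by (rule dvd_trans[rotated])
    then show "int p dvd x" by (simp add: dvd_diff_left_iff)
  next
    assume "int p dvd x"
    then obtain y where "x = int p * y" by (rule dvdE)
    then show "of_nat p dvd (of_int x :: 'q mod_ring)" by simp
  qed
  show ?thesis
  proof unfold_locales
    show "reduce (0 :: 'q mod_ring) = (0 :: 'p mod_ring)" using red[of 0] by simp
    show "reduce (1 :: 'q mod_ring) = (1 :: 'p mod_ring)" using red[of 1] by simp
    show "surj (reduce :: 'q mod_ring \<Rightarrow> 'p mod_ring)"
      unfolding surj_def using of_int_mod_ring_surj red by metis
    show "(of_nat p :: 'q mod_ring) ^ r = 0"
      using of_int_mod_ring_eq_0_iff[of "int p ^ r", where ?'q = 'q] q by simp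
    fix a b :: "'q mod_ring"
    show "reduce (a + b) = (reduce a + reduce b :: 'p mod_ring)"
      "reduce (a * b) = (reduce a * reduce b :: 'p mod_ring)" by (fact hom)+
    obtain x where x: "a = of_int x" using of_int_mod_ring_surj by blast
    show "(reduce a :: 'p mod_ring) = 0 \<longleftrightarrow> of_nat p dvd a"
      unfolding x p_dvd red of_int_mod_ring_eq_0_iff p ..
    have "of_nat p ^ (r - 1) * a = of_int (int p ^ (r - 1) * x)" by (simp add: x)
    also have "\<dots> = 0 \<longleftrightarrow> int p ^ (r - 1) * int p dvd int p ^ (r - 1) * x"
      unfolding of_int_mod_ring_eq_0_iff q using assms(2) by (cases r) (simp_all add: mult.commute)
    also have "\<dots> \<longleftrightarrow> int p dvd x" using p_pos by simp
    also have "\<dots> \<longleftrightarrow> of_nat p dvd a" unfolding x p_dvd ..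
    finally show "of_nat p ^ (r - 1) * a = 0 \<longleftrightarrow> of_nat p dvd a" .
  qed
qed

section \<open>Reduced internal degree matrices and the equivalence for codes\<close>

lemma reduced_internal_degree_matrix_exists:
  assumes "free_convolutional_code k n C"
  shows "\<exists>G. reduced_internal_degree_matrix k n C G"
proof -
  obtain G where "generator_matrix k n C G" using assms by (auto simp: free_convolutional_code_def)
  from ex_has_least_nat[of "generator_matrix k n C", OF this, of internal_degree]
  show ?thesis unfolding reduced_internal_degree_matrix_def by blast
qed

theorem theorem3p3:
  fixes p r k n :: nat
    and C :: "'q::nontriv mod_ring fls vec set"
  assumes "prime p" and "r \<ge> 1"
    and "CARD('p::prime_card) = p" and "CARD('q) = p ^ r"
    and "free_convolutional_code k n C"
  shows "noncatastrophic_code k n C \<longleftrightarrow>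
    (\<exists>s::nat. (residual_structural_polynomial k n C :: 'p mod_ring poly) = Polynomial.monom 1 s)"
proof -
  interpret nilpotent_reduction "reduce :: 'q mod_ring \<Rightarrow> 'p mod_ring" "of_nat p" r
    by (rule nilpotent_reduction_mod_ring) (use assms in auto)
  define G where "G = (SOME G. reduced_internal_degree_matrix k n C G)"
  have G: "reduced_internal_degree_matrix k n C G"
    unfolding G_def using reduced_internal_degree_matrix_exists[OF assms(5)] by (rule someI_ex)
  then have gG: "generator_matrix k n C G" by (simp add: reduced_internal_degree_matrix_def)
  then have cG: "G \<in> carrier_mat k n" "full_rank G" by (simp_all add: generator_matrix_def)
  have \<Delta>: "residual_structural_polynomial k n C = Gcd (full_minors (redm G))"
    by (simp add: residual_structural_polynomial_def gcd_minors_mod_p_def reduce_mat_def G_def)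
  show ?thesis
    unfolding \<Delta>
  proof
    assume "noncatastrophic_code k n C"
    then obtain G' where "generator_matrix k n C G'" "noncatastrophic_matrix G'"
      by (auto simp: noncatastrophic_code_def)
    \<comment> \<open>\<open>G'\<close> may differ from the selected \<open>G\<close>; minimality of
      the internal degree transfers the right factor to \<open>G\<close>, whose minors define the
      residual structural polynomial.\<close>
    from right_factor_of_reduced_internal_degree[OF G this] obtain Q m
      where Q: "Q \<in> carrier_mat n k" "G * Q = monom 1 m \<cdot>\<^sub>m 1\<^sub>m k" .
    show "\<exists>s. Gcd (full_minors (redm G)) = monom 1 s"
      by (rule Gcd_minors_of_noncatastrophic[OF cG noncatastrophic_of_right_factor[OF cG(1) Q]])
  next
    assume "\<exists>s. Gcd (full_minors (redm G)) = monom 1 s"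
    then obtain s where "Gcd (full_minors (redm G)) = monom 1 s" ..
    then obtain Q m where "Q \<in> carrier_mat n k" "G * Q = monom 1 m \<cdot>\<^sub>m 1\<^sub>m k"
      by (rule right_factor_of_Gcd_minors[OF cG(1)])
    then have "noncatastrophic_matrix G" by (rule noncatastrophic_of_right_factor[OF cG(1)])
    then show "noncatastrophic_code k n C" using gG by (auto simp: noncatastrophic_code_def)
  qed
qed

end
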